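(* The property of being a special co-ET0L group is independent of the choice of finite generating set: if $A$ and $B$ are finite inverse-closed generating sets of a group $G$, then $\mathsf{coWP}(G,A)$ is accepted by a special cspda with input alphabet $A$ if and only if $\mathsf{coWP}(G,B)$ is accepted by a special cspda with input alphabet $B$. Furthermore, the class of special co-ET0L groups is closed under: (1) passing to finitely generated subgroups (every finitely generated subgroup of a special co-ET0L group is a special co-ET0L group); (2) finite direct products (the direct product of finitely many special co-ET0L groups is a special co-ET0L group); (3) finite extensions (if a group $G$ has a subgroup $H$ of finite index that is a special co-ET0L group, then $G$ is a special co-ET0L group).
   Context: **Check stack pushdown automata (cspda).** A cspda $M$ over a finite input alphabet $A$ is a non-deterministic finite-state automaton (with a finite set of states, a single initial state, and a subset of accepting states) with a one-way input tape, a check stack with finite alphabet $\Delta$ and a pushdown stack with finite alphabet $\Gamma$. A computation has two stages. - First stage (initialisation): starting from the initial state, $M$ non-deterministically pushes symbols onto the check stack under the control of its finite-state control. It does not read input and does not use the pushdown stack. (So the possible check stack contents form a regular language.) - Second stage: the check stack is never altered. $M$ may read letters from the input tape and push symbols onto, or pop symbols from, the pushdown stack. The read-write head is always at the top of the pushdown stack and at the corresponding height on the check stack (it moves up by one on both when a symbol is pushed and down by one when a symbol is popped). Each transition depends on the current state, the top pushdown symbol, the check stack symbol at the same height, and, if it is a reading transition, the next input letter, which is consumed. It changes the state and may push or pop. $M$ accepts $w\in A^*$ if some computation enters an accepting state at some stage after reading all of $w$; $L(M)$ is the set of accepted words. A configuration consists of the state and the contents of the two stacks. **Special cspda.** $M$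 is special if (P1)–(P7) hold. - (P1) Each state is either reading (all its out-transitions read an input letter) or non-reading (none of its out-transitions reads an input letter). - (P2) The operation of $M$ throughout the second stage is deterministic. - (P3) $\Delta$ and $\Gamma$ both contain a bottom-of-stack symbol $\mathfrak b$ and a padding symbol $\mathsf p$, and $\Delta$ contains a top-of-stack symbol $\mathfrak t$. After initialisation the check stack has $\mathfrak b$ at the bottom and $\mathfrak t$ at the top. The first transition of the second stage writes $\mathfrak b$ at the bottom of the pushdown stack, after which $M$ moves into a reading state. The symbol $\mathfrak b$ occurs only at the bottoms of the two stacks, $\mathfrak t$ occurs only at the top of the check stack, $\mathfrak b$ is never popped, and when $\mathfrak t$ is seen on the check stack no symbol can be pushed (so the head never moves above the top of the check stack). - (P4) No computation contains an infinitely long sequence of non-reading transitions in the second stage. - (P5) All accepting states are reading states. - (P6) For every entry configuration $C$ and all $u,v\in A^*$ with $v\notin L(M)$, either $C^{uv}=C^u$ or $C^{uv}$ fails. - (P7) The accepting states are exactly the reading states that are not entry states. Terminology used here: a configuration is reading (accepting) if its state is reading (accepting). An entry configuration is one arising immediately after the first transition of the second stage (the one writing $\mathfrak b$ on the pushdown stack), and its state is an entry state. A failing configuration is a non-accepting reading configuration from which no accepting configuration can be reached. For a reading configuration $C$ and $w\in A^*$, $C^w$ is the configuration of $M$, run in the second stage from $C$ on input $w$, as it enters its first reading state after reading all of $w$ (so $C^{\epsilon}=C$ for the empty word $\epsilon$). $C^w$ fails if a failing configuration is entered in this process, or if the machine gets stuck before reaching such a reading state. **Special co-ET0L groups.** A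 language accepted by a special cspda is a special ET0L language. For a group $G$ with finite inverse-closed generating set $A$, $\mathsf{coWP}(G,A)=\{w\in A^*: w\neq_G 1\}$. A finitely generated group $G$ is a special co-ET0L group if, for some finite inverse-closed generating set $A$ of $G$, some special cspda with input alphabet $A$ (and, by convention, $A\subseteq\Delta$, $A\subseteq\Gamma$) accepts $\mathsf{coWP}(G,A)$. *)

theory Defs
  imports "HOL-Algebra.Product_Groups"
begin

section \<open>Check stack pushdown automata\<close>

datatype 'g stack_action = Stay | Push 'g | Pop

text \<open>
  A rule of the second stage.  The field \<open>letter\<close> is \<open>None\<close> for a non-reading rule.  The fields
  \<open>ck_sym\<close> and \<open>pd_sym\<close> are the symbols that must be seen at the head on the check stack and
  on the pushdown stack; \<open>None\<close> stands for the absence of a symbol.  In particular both are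
  \<open>None\<close> at the start of the second stage, when the pushdown stack is empty and the head is
  still below the bottom of both stacks.
\<close>

record ('q, 'a, 'd, 'g) rule =
  src :: 'q
  letter :: "'a option"
  ck_sym :: "'d option"
  pd_sym :: "'g option"
  act :: "'g stack_action"
  tgt :: 'q

text \<open>
  An element \<open>(q, d, q')\<close> of \<open>init_rules\<close> is a first-stage transition from \<open>q\<close> to \<open>q'\<close> pushing
  \<open>d\<close> onto the check stack.  The second stage begins when the first element of \<open>rules\<close> is
  applied; from then on \<open>init_rules\<close> can no longer be used.
\<close>

record ('q, 'a, 'd, 'g) cspda =
  states :: "'q set"
  input_alphabet :: "'a set"
  check_alphabet :: "'d set"
  push_alphabet :: "'g set"
  init_state :: 'q
  accepting_states :: "'q set"
  init_rules :: "('q \<times> 'd \<times> 'q) set"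
  rules :: "('q, 'a, 'd, 'g) rule set"

definition is_cspda :: "('q, 'a, 'd, 'g) cspda \<Rightarrow> bool" where
  "is_cspda M \<longleftrightarrow>
     finite (states M) \<and> finite (input_alphabet M) \<and>
     finite (check_alphabet M) \<and> finite (push_alphabet M) \<and>
     init_state M \<in> states M \<and> accepting_states M \<subseteq> states M \<and>
     init_rules M \<subseteq> states M \<times> check_alphabet M \<times> states M \<and>
     (\<forall>r\<in>rules M.
        src r \<in> states M \<and> tgt r \<in> states M \<and>
        set_option (letter r) \<subseteq> input_alphabet M \<and>
        set_option (ck_sym r) \<subseteq> check_alphabet M \<and>
        set_option (pd_sym r) \<subseteq> push_alphabet M \<and>
        set_stack_action (act r) \<subseteq> push_alphabet M \<and>
        (act r = Pop \<longrightarrow> pd_sym r \<noteq> None))"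

text \<open>
  A configuration \<open>(q, cs, ps)\<close>: the check stack \<open>cs\<close> is listed from bottom to top, the pushdown
  stack \<open>ps\<close> from top to bottom.  The head is at height \<open>length ps\<close> on both stacks.
\<close>

type_synonym ('q, 'd, 'g) config = "'q \<times> 'd list \<times> 'g list"

inductive initialises :: "('q, 'a, 'd, 'g) cspda \<Rightarrow> 'q \<Rightarrow> 'd list \<Rightarrow> bool"
  for M where
  init_start: "initialises M (init_state M) []"
| init_push: "initialises M q cs \<Longrightarrow> (q, d, q') \<in> init_rules M \<Longrightarrow> initialises M q' (cs @ [d])"

definition symbol_at :: "'d list \<Rightarrow> nat \<Rightarrow> 'd option" where
  "symbol_at cs h = (if 1 \<le> h \<and> h \<le> length cs then Some (cs ! (h - 1)) else None)"

definition top_symbol :: "'g list \<Rightarrow> 'g option" where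
  "top_symbol ps = (case ps of [] \<Rightarrow> None | g # _ \<Rightarrow> Some g)"

fun perform :: "'g stack_action \<Rightarrow> 'g list \<Rightarrow> 'g list" where
  "perform Stay ps = ps"
| "perform (Push g) ps = g # ps"
| "perform Pop ps = tl ps"

inductive step ::
  "('q, 'a, 'd, 'g) cspda \<Rightarrow> 'a option \<Rightarrow> ('q, 'd, 'g) config \<Rightarrow> ('q, 'd, 'g) config \<Rightarrow> bool"
  for M where
  "r \<in> rules M \<Longrightarrow> ck_sym r = symbol_at cs (length ps) \<Longrightarrow> pd_sym r = top_symbol ps \<Longrightarrow>
     step M (letter r) (src r, cs, ps) (tgt r, cs, perform (act r) ps)"

inductive run ::
  "('q, 'a, 'd, 'g) cspda \<Rightarrow> ('q, 'd, 'g) config \<Rightarrow> 'a list \<Rightarrow> ('q, 'd, 'g) config \<Rightarrow> bool"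
  for M where
  run_refl: "run M C [] C"
| run_silent: "step M None C D \<Longrightarrow> run M D w E \<Longrightarrow> run M C w E"
| run_read: "step M (Some a) C D \<Longrightarrow> run M D w E \<Longrightarrow> run M C (a # w) E"

definition accepting_config :: "('q, 'a, 'd, 'g) cspda \<Rightarrow> ('q, 'd, 'g) config \<Rightarrow> bool" where
  "accepting_config M C \<longleftrightarrow> fst C \<in> accepting_states M"

definition language :: "('q, 'a, 'd, 'g) cspda \<Rightarrow> 'a list set" where
  "language M = {w \<in> lists (input_alphabet M).
     \<exists>q cs C. initialises M q cs \<and> run M (q, cs, []) w C \<and> accepting_config M C}"


section \<open>Special automata\<close>

text \<open>First-stage transitions count as out-transitions that do not read.\<close>

definition reading_state :: "('q, 'a, 'd, 'g) cspda \<Rightarrow> 'q \<Rightarrow> bool" where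
  "reading_state M q \<longleftrightarrow> q \<in> states M \<and>
     (\<forall>(p, d, p')\<in>init_rules M. p \<noteq> q) \<and> (\<forall>r\<in>rules M. src r = q \<longrightarrow> letter r \<noteq> None)"

definition nonreading_state :: "('q, 'a, 'd, 'g) cspda \<Rightarrow> 'q \<Rightarrow> bool" where
  "nonreading_state M q \<longleftrightarrow> q \<in> states M \<and> (\<forall>r\<in>rules M. src r = q \<longrightarrow> letter r = None)"

definition reading_config :: "('q, 'a, 'd, 'g) cspda \<Rightarrow> ('q, 'd, 'g) config \<Rightarrow> bool" where
  "reading_config M C \<longleftrightarrow> reading_state M (fst C)"

definition entry_config :: "('q, 'a, 'd, 'g) cspda \<Rightarrow> ('q, 'd, 'g) config \<Rightarrow> bool" where
  "entry_config M C \<longleftrightarrow> (\<exists>q cs x. initialises M q cs \<and> step M x (q, cs, []) C)"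

definition entry_state :: "('q, 'a, 'd, 'g) cspda \<Rightarrow> 'q \<Rightarrow> bool" where
  "entry_state M q \<longleftrightarrow> (\<exists>C. entry_config M C \<and> fst C = q)"

definition failing_config :: "('q, 'a, 'd, 'g) cspda \<Rightarrow> ('q, 'd, 'g) config \<Rightarrow> bool" where
  "failing_config M C \<longleftrightarrow> reading_config M C \<and> \<not> accepting_config M C \<and>
     \<not> (\<exists>w D. run M C w D \<and> accepting_config M D)"

text \<open>
  \<open>arrives M C w D\<close> expresses \<open>C\<^sup>w = D\<close>.  As a reading configuration has no silent successor,
  a reading configuration reached after reading all of \<open>w\<close> is always the first one.
\<close>

definition arrives ::
  "('q, 'a, 'd, 'g) cspda \<Rightarrow> ('q, 'd, 'g) config \<Rightarrow> 'a list \<Rightarrow> ('q, 'd, 'g) config \<Rightarrow> bool" where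
  "arrives M C w D \<longleftrightarrow> run M C w D \<and> reading_config M D"

text \<open>
  The second disjunct is the case of getting stuck: in a special automaton the run cannot
  continue silently for ever.
\<close>

definition fails :: "('q, 'a, 'd, 'g) cspda \<Rightarrow> ('q, 'd, 'g) config \<Rightarrow> 'a list \<Rightarrow> bool" where
  "fails M C w \<longleftrightarrow>
     (\<exists>u v D. w = u @ v \<and> run M C u D \<and> failing_config M D) \<or> \<not> (\<exists>D. arrives M C w D)"

definition deterministic_second_stage :: "('q, 'a, 'd, 'g) cspda \<Rightarrow> bool" where
  "deterministic_second_stage M \<longleftrightarrow>
     (\<forall>r\<in>rules M. \<forall>s\<in>rules M.
        src r = src s \<and> ck_sym r = ck_sym s \<and> pd_sym r = pd_sym s \<and>
        (letter r = letter s \<or> letter r = None \<or> letter s = None) \<longrightarrow> r = s)"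

definition silent_terminating :: "('q, 'a, 'd, 'g) cspda \<Rightarrow> bool" where
  "silent_terminating M \<longleftrightarrow>
     (\<forall>q cs w C. initialises M q cs \<longrightarrow> run M (q, cs, []) w C \<longrightarrow>
        \<not> (\<exists>f :: nat \<Rightarrow> _. f 0 = C \<and> (\<forall>n. step M None (f n) (f (Suc n)))))"

definition trivial_words_return :: "('q, 'a, 'd, 'g) cspda \<Rightarrow> bool" where
  "trivial_words_return M \<longleftrightarrow>
     (\<forall>C. entry_config M C \<longrightarrow>
       (\<forall>u\<in>lists (input_alphabet M). \<forall>v\<in>lists (input_alphabet M). v \<notin> language M \<longrightarrow>
          (\<exists>D. arrives M C u D \<and> arrives M C (u @ v) D) \<or> fails M C (u @ v)))"

text \<open>
  Stack symbols over the input letters \<open>'a\<close>: the distinguished symbols, the input letters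
  themselves, and an unlimited supply of further symbols.
\<close>

datatype 'a stack_symbol = Bottom | Top | Padding | Letter 'a | Other nat

text \<open>
  Initialisation is over once a rule of the second stage is applied; the second conjunct
  concerns this first rule, the third one all rules.
\<close>

definition stack_discipline ::
  "('q, 'a, 'a stack_symbol, 'a stack_symbol) cspda \<Rightarrow> bool" where
  "stack_discipline M \<longleftrightarrow>
     {Bottom, Top, Padding} \<subseteq> check_alphabet M \<and> {Bottom, Padding} \<subseteq> push_alphabet M \<and>
     (\<forall>q cs x C. initialises M q cs \<longrightarrow> step M x (q, cs, []) C \<longrightarrow>
        (\<exists>mid. cs = Bottom # mid @ [Top] \<and> Bottom \<notin> set mid \<and> Top \<notin> set mid) \<and>
        x = None \<and> (\<exists>q'. C = (q', cs, [Bottom]) \<and> reading_state M q')) \<and>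
     (\<forall>r\<in>rules M.
        (act r = Pop \<longrightarrow> pd_sym r \<noteq> Some Bottom) \<and>
        (act r = Push Bottom \<longrightarrow> pd_sym r = None) \<and>
        act r \<noteq> Push Top \<and>
        (ck_sym r = Some Top \<longrightarrow> (\<forall>g. act r \<noteq> Push g)))"

definition special_cspda ::
  "('q, 'a, 'a stack_symbol, 'a stack_symbol) cspda \<Rightarrow> bool" where
  "special_cspda M \<longleftrightarrow> is_cspda M \<and>
     (\<forall>q\<in>states M. reading_state M q \<or> nonreading_state M q) \<and>
     deterministic_second_stage M \<and>
     stack_discipline M \<and>
     silent_terminating M \<and>
     (\<forall>q\<in>accepting_states M. reading_state M q) \<and>
     trivial_words_return M \<and>
     accepting_states M = {q. reading_state M q \<and> \<not> entry_state M q}"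

text \<open>
  Since an automaton has finitely many states, these may be taken to be natural numbers.
\<close>

definition special_ET0L :: "'a set \<Rightarrow> 'a list set \<Rightarrow> bool" where
  "special_ET0L A L \<longleftrightarrow>
     (\<exists>M :: (nat, 'a, 'a stack_symbol, 'a stack_symbol) cspda.
        special_cspda M \<and> input_alphabet M = A \<and>
        Letter ` A \<subseteq> check_alphabet M \<and> Letter ` A \<subseteq> push_alphabet M \<and>
        language M = L)"


section \<open>Special co-ET0L groups\<close>

definition finite_symmetric_generating_set :: "('a, 'm) monoid_scheme \<Rightarrow> 'a set \<Rightarrow> bool" where
  "finite_symmetric_generating_set G A \<longleftrightarrow>
     finite A \<and> A \<subseteq> carrier G \<and> (\<forall>a\<in>A. inv\<^bsub>G\<^esub> a \<in> A) \<and> generate G A = carrier G"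

definition word_value :: "('a, 'm) monoid_scheme \<Rightarrow> 'a list \<Rightarrow> 'a" where
  "word_value G w = foldr (\<lambda>a g. a \<otimes>\<^bsub>G\<^esub> g) w \<one>\<^bsub>G\<^esub>"

definition coWP :: "('a, 'm) monoid_scheme \<Rightarrow> 'a set \<Rightarrow> 'a list set" where
  "coWP G A = {w \<in> lists A. word_value G w \<noteq> \<one>\<^bsub>G\<^esub>}"

definition special_coET0L_group :: "('a, 'm) monoid_scheme \<Rightarrow> bool" where
  "special_coET0L_group G \<longleftrightarrow> group G \<and>
     (\<exists>A. finite_symmetric_generating_set G A \<and> special_ET0L A (coWP G A))"

end

theory Submission
  imports Defs "HOL-Library.Countable_Set"
begin

text \<open>
  All closure properties come from one construction.  A finite family of special machines \<open>M i\<close> is run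
  behind finite-state transducers that rewrite each letter \<open>b\<close>, read in transducer state \<open>j\<close>, into
  a word \<open>out i j b\<close> over the alphabet of \<open>M i\<close> and move to \<open>\<delta> j b\<close>; the word is consumed by
  non-reading moves.  The index \<open>i\<close> and the initial \<open>j\<close> are guessed with the check stack.  The result is
  special provided that every word outside the accepted language fixes every \<open>j\<close>.

  For subgroups (hence changes of generators) and direct products a single \<open>j\<close> suffices: letters are
  rewritten along homomorphisms that are jointly injective.  For an extension of \<open>H\<close> of finite
  index, \<open>j\<close> runs over the right cosets, with representatives \<open>r c\<close>, and a letter \<open>b\<close> is rewritten
  into a word for \<open>r c b (r (c b))\<inverse> \<in> H\<close>; a second machine, testing the parity of the number of
  passages into or out of the coset \<open>H\<close>, detects the words outside \<open>H\<close>.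
\<close>

section \<open>Runs of special automata\<close>

text \<open>Three of the conditions shape the construction. By (P7) acceptance is determined by the
  entry states; since every \<open>j\<close> is allowed at the start,
  \<open>state (i, q, j, [])\<close> accepts or not according to \<open>q\<close> alone. A change of
  the transducer state is therefore invisible to acceptance, and for extensions the departure from
  the coset \<open>H\<close> has to be recorded by an automaton of its own. Acceptance is also
  existential in \<open>j\<close>, so a start in an unintended \<open>j\<close> must never accept a
  word of value one; for cosets this holds because such a word fixes each of them. Condition (P6)
  asks for the return of the whole configuration after a rejected word, and the transducer state is
  a part of it: hence the requirement that rejected words fix every \<open>j\<close>. By (P1) a
  state cannot both read and work silently. Pending letters are kept in a buffer inside the state,
  and a combined state is reading only if the buffer is empty and the state of \<open>M i\<close> is
  reading. The runs of \<open>M i\<close> must then be cut exactly at the borders between rewritten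
  letters.\<close>

lemma step_intro:
  assumes "r \<in> rules M" "ck_sym r = symbol_at cs (length ps)" "pd_sym r = top_symbol ps"
    "x = letter r" "C = (src r, cs, ps)" "D = (tgt r, cs, perform (act r) ps)"
  shows "step M x C D"
  using step.intros[OF assms(1-3)] assms(4-6) by simp

lemma step_elim:
  assumes "step M x C D"
  obtains r cs ps where "r \<in> rules M" "ck_sym r = symbol_at cs (length ps)"
    "pd_sym r = top_symbol ps" "x = letter r" "C = (src r, cs, ps)"
    "D = (tgt r, cs, perform (act r) ps)"
  using assms by (cases rule: step.cases) auto

lemma special_cspdaD:
  assumes "special_cspda M"
  shows "is_cspda M" "q \<in> states M \<Longrightarrow> reading_state M q \<or> nonreading_state M q"
    "deterministic_second_stage M" "stack_discipline M" "silent_terminating M"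
    "trivial_words_return M"
    "accepting_states M = {q. reading_state M q \<and> \<not> entry_state M q}"
  using assms unfolding special_cspda_def by blast+

lemma run_append: "run M C u D \<Longrightarrow> run M D v E \<Longrightarrow> run M C (u @ v) E"
  by (induction rule: run.induct) (auto intro: run.intros)

lemma step_deterministic:
  assumes "deterministic_second_stage M" "step M x C D" "step M y C E" "x = y \<or> x = None \<or> y = None"
  shows "x = y \<and> D = E"
  using assms(2)
proof (cases rule: step_elim)
  case r: (1 r cs ps)
  from assms(3) show ?thesis
  proof (cases rule: step_elim)
    case s: (1 s cs' ps')
    have "src r = src s \<and> ck_sym r = ck_sym s \<and> pd_sym r = pd_sym s \<and>
        (letter r = letter s \<or> letter r = None \<or> letter s = None)"
      using r s assms(4) by simp
    then have "r = s"
      using assms(1) r(1) s(1) unfolding deterministic_second_stage_def by blast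
    then show ?thesis using r s by simp
  qed
qed

lemma reading_config_not_silent: "reading_config M C \<Longrightarrow> \<not> step M None C D"
  by (auto simp: reading_config_def reading_state_def elim!: step_elim)

text \<open>Determinism makes the two runs take the same steps up to \<open>D\<close>. That
  \<open>E\<close> is reading prevents the longer run from ending before \<open>D\<close> with
  silent steps still ahead.\<close>

lemma run_unique_suffix:
  assumes det: "deterministic_second_stage M"
    and "run M C u D" "reading_config M D" "run M C (u @ v) E" "reading_config M E"
  shows "run M D v E"
  using assms(2-5)
proof (induction rule: run.induct)
  case (run_silent C C' D w)
  from run_silent.prems(2) show ?case
  proof (cases rule: run.cases)
    case run_refl
    then show ?thesis using run_silent.hyps(1) run_silent.prems(3) reading_config_not_silent by metis
  next
    case (run_silent C'')
    then show ?thesis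
      using run_silent.IH run_silent.prems run_silent.hyps(1) step_deterministic[OF det] by metis
  next
    case (run_read a C'' w')
    then show ?thesis using run_silent.hyps(1) step_deterministic[OF det] by blast
  qed
next
  case (run_read a C C' D w)
  from run_read.prems(2) show ?case
  proof (cases rule: run.cases)
    case (run_silent C'')
    then show ?thesis using run_read.hyps(1) step_deterministic[OF det] by blast
  next
    case (run_read a' C'' w')
    then show ?thesis
      using run_read.IH run_read.prems run_read.hyps(1) step_deterministic[OF det]
      by (metis append_Cons list.inject)
  qed simp
qed simp

text \<open>The source of a reading rule is not a non-reading state, so (P1) leaves only one
  possibility.\<close>

lemma read_step_reading_config:
  assumes "special_cspda M" "step M (Some a) C D"
  shows "reading_config M C"
  using assms(2)
proof (cases rule: step_elim)
  case (1 r cs ps)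
  have "src r \<in> states M" "\<not> nonreading_state M (src r)"
    using 1 special_cspdaD(1)[OF assms(1)] unfolding is_cspda_def nonreading_state_def
    by (blast, metis option.distinct(1))
  then show ?thesis
    using special_cspdaD(2)[OF assms(1)] 1 unfolding reading_config_def by auto
qed

text \<open>A letter can only be read from a reading configuration, so the run pauses in one after \<open>u\<close>.\<close>

lemma arrives_split:
  assumes "special_cspda M" "arrives M C (u @ v) E"
  obtains D where "arrives M C u D" "arrives M D v E"
proof -
  have "run M C w E \<Longrightarrow> w = u @ v \<Longrightarrow> reading_config M E \<Longrightarrow>
      \<exists>D. arrives M C u D \<and> arrives M D v E" for w
  proof (induction arbitrary: u rule: run.induct)
    case (run_refl C)
    then show ?case
      using run.run_refl[of M C] by (intro exI[of _ C]) (simp add: arrives_def)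
  next
    case (run_silent C C' w E)
    then show ?case
      using run.run_silent[OF run_silent.hyps(1)] unfolding arrives_def by blast
  next
    case (run_read a C C' w E)
    show ?case
    proof (cases u)
      case Nil
      then have "run M C v E"
        using run_read.hyps run_read.prems run.run_read[of M a C C' w E] by simp
      then show ?thesis
        using Nil run_read.prems read_step_reading_config[OF assms(1) run_read.hyps(1)] run.run_refl[of M C]
        unfolding arrives_def by blast
    next
      case (Cons a' u')
      then obtain D where "arrives M C' u' D" "arrives M D v E" "a' = a"
        using run_read.IH[of u'] run_read.prems by auto
      then show ?thesis
        using Cons run.run_read[OF run_read.hyps(1), of u' D] unfolding arrives_def by blast
    qed
  qed
  then show ?thesis using assms(2) that unfolding arrives_def by blast
qed

lemma failing_config_arrives:
  assumes "failing_config M C" "arrives M C w D"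
  shows "failing_config M D"
  using assms unfolding failing_config_def arrives_def by (meson run_append)

section \<open>Invariants of the two stacks\<close>

text \<open>The renaming of stack symbols used later is injective only on the alphabets of the given
  automata. Steps of the combined automaton are decoded on configurations that stay inside these
  alphabets.\<close>

definition well_stacked :: "('q, 'a, 'd, 'g) cspda \<Rightarrow> ('q, 'd, 'g) config \<Rightarrow> bool" where
  "well_stacked M C \<longleftrightarrow> (case C of (q, cs, ps) \<Rightarrow>
     q \<in> states M \<and> set cs \<subseteq> check_alphabet M \<and> set ps \<subseteq> push_alphabet M)"

lemma initialises_well_stacked:
  assumes "is_cspda M" "initialises M q cs"
  shows "well_stacked M (q, cs, [])"
  using assms(2)
  by induction (use assms(1) in \<open>auto simp: well_stacked_def is_cspda_def\<close>)

lemma step_well_stacked: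
  assumes "is_cspda M" "step M x C D" "well_stacked M C"
  shows "well_stacked M D"
  using assms(2)
proof (cases rule: step_elim)
  case (1 r cs ps)
  then show ?thesis
    using assms(1,3) by (cases "act r"; cases ps) (fastforce simp: well_stacked_def is_cspda_def)+
qed

text \<open>The pushdown stack is listed from the top, so its bottom is \<open>last ps\<close>. The
  purpose is nonemptiness, since the rules that read a letter will demand a pushdown symbol;
  recording \<open>Bottom\<close> makes this inductive, as \<open>Bottom\<close> is never
  popped.\<close>

definition bottomed :: "('q, 'a stack_symbol, 'a stack_symbol) config \<Rightarrow> bool" where
  "bottomed C \<longleftrightarrow> (case C of (q, cs, ps) \<Rightarrow> ps \<noteq> [] \<and> last ps = Bottom)"

lemma step_bottomed:
  assumes "stack_discipline M" "step M x C D" "bottomed C"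
  shows "bottomed D"
  using assms(2)
proof (cases rule: step_elim)
  case (1 r cs ps)
  then show ?thesis
    using assms(1,3)
    by (cases "act r"; cases ps) (auto simp: bottomed_def stack_discipline_def top_symbol_def split: if_splits)
qed

lemma entry_config_bottomed:
  assumes "stack_discipline M" "entry_config M C"
  shows "bottomed C"
  using assms unfolding entry_config_def stack_discipline_def bottomed_def by fastforce

lemma entry_config_well_stacked:
  assumes "is_cspda M" "entry_config M C"
  shows "well_stacked M C"
  using assms unfolding entry_config_def
  by (meson initialises_well_stacked step_well_stacked)

section \<open>Rewriting of words, and renaming of stack symbols\<close>

primrec transduce :: "('j \<Rightarrow> 'b \<Rightarrow> 'j) \<Rightarrow> ('j \<Rightarrow> 'b \<Rightarrow> 'a list) \<Rightarrow> 'j \<Rightarrow> 'b list \<Rightarrow> 'a list" where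
  "transduce \<delta> f j [] = []"
| "transduce \<delta> f j (b # w) = f j b @ transduce \<delta> f (\<delta> j b) w"

lemma transduce_append:
  "transduce \<delta> f j (u @ v) = transduce \<delta> f j u @ transduce \<delta> f (foldl \<delta> j u) v"
  by (induction u arbitrary: j) auto

fun letter_word :: "'a option \<Rightarrow> 'a list" where
  "letter_word None = []"
| "letter_word (Some a) = [a]"

lemma letter_word_simps [simp]:
  "set (letter_word x) = set_option x" "letter_word x = [] \<longleftrightarrow> x = None"
  by (cases x; simp)+

lemma run_step: "step M x C D \<Longrightarrow> run M D w E \<Longrightarrow> run M C (letter_word x @ w) E"
  by (cases x) (auto intro: run.intros)

text \<open>In a special automaton the first step of the second stage yields the entry
  configuration. Splitting it off reduces questions about runs to runs from entry
  configurations.\<close>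

lemma run_from_start:
  assumes "run M' (q, cs, []) w C"
  shows "w = [] \<and> C = (q, cs, []) \<or>
    (\<exists>x D v. step M' x (q, cs, []) D \<and> run M' D v C \<and> w = letter_word x @ v)"
  using assms
proof (cases rule: run.cases)
  case (run_silent D)
  then show ?thesis by (intro disjI2 exI[of _ None] exI[of _ D] exI[of _ w]) simp
next
  case (run_read a D v)
  then show ?thesis by (intro disjI2 exI[of _ "Some a"] exI[of _ D] exI[of _ v]) simp
qed simp

lemma symbol_at_map: "symbol_at (map f cs) h = map_option f (symbol_at cs h)"
  by (auto simp: symbol_at_def)

lemma top_symbol_map: "top_symbol (map f ps) = map_option f (top_symbol ps)"
  by (cases ps) (auto simp: top_symbol_def)

lemma perform_map: "perform (map_stack_action f x) (map f ps) = map f (perform x ps)"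
  by (cases x) (auto simp: map_tl)

lemma set_symbol_at: "set_option (symbol_at cs h) \<subseteq> set cs"
  by (auto simp: symbol_at_def)

lemma set_top_symbol: "set_option (top_symbol ps) \<subseteq> set ps"
  by (cases ps) (auto simp: top_symbol_def)

lemma map_option_inj_on:
  "inj_on f S \<Longrightarrow> set_option x \<subseteq> S \<Longrightarrow> set_option y \<subseteq> S \<Longrightarrow> map_option f x = map_option f y \<longleftrightarrow> x = y"
  by (cases x; cases y) (auto dest: inj_onD)

section \<open>Running a family of automata behind transducers\<close>

locale transducer_family =
  fixes I :: "'i set"
    and M :: "'i \<Rightarrow> (nat, 'a, 'a stack_symbol, 'a stack_symbol) cspda"
    and B :: "'b set"
    and J :: "'j set"
    and \<delta> :: "'j \<Rightarrow> 'b \<Rightarrow> 'j"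
    and out :: "'i \<Rightarrow> 'j \<Rightarrow> 'b \<Rightarrow> 'a list"
  assumes finite_I: "finite I" and finite_B: "finite B" and finite_J: "finite J"
    and special: "i \<in> I \<Longrightarrow> special_cspda (M i)"
    and Nil_rejected: "i \<in> I \<Longrightarrow> [] \<notin> language (M i)"
    and \<delta>_closed: "j \<in> J \<Longrightarrow> b \<in> B \<Longrightarrow> \<delta> j b \<in> J"
    and out_lists: "i \<in> I \<Longrightarrow> j \<in> J \<Longrightarrow> b \<in> B \<Longrightarrow> out i j b \<in> lists (input_alphabet (M i))"
begin

section \<open>States, symbols and rules of the combined automaton\<close>

definition max_out :: nat where
  "max_out = Max (insert 0 ((\<lambda>(i, j, b). length (out i j b)) ` (I \<times> J \<times> B)))"

definition buffers :: "'i \<Rightarrow> 'a list set" where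
  "buffers i = {buf. set buf \<subseteq> input_alphabet (M i) \<and> length buf \<le> max_out}"

definition tuples :: "('i \<times> nat \<times> 'j \<times> 'a list) set" where
  "tuples = (SIGMA i:I. states (M i) \<times> J \<times> buffers i)"

text \<open>The state \<open>0\<close> is kept for the initial state.\<close>

definition state :: "'i \<times> nat \<times> 'j \<times> 'a list \<Rightarrow> nat" where
  "state t = Suc (to_nat_on tuples t)"

definition symbols :: "'a stack_symbol set" where
  "symbols = (\<Union>i\<in>I. check_alphabet (M i) \<union> push_alphabet (M i))"

text \<open>The new stack symbols are built over another type of letters, so the old ones are
  numbered as \<open>Other\<close>. \<open>Bottom\<close> and \<open>Top\<close> are kept because
  the stack discipline speaks of them; the padding symbol of \<open>M i\<close> becomes an ordinary
  symbol, distinct from the new \<open>Padding\<close>.\<close>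

definition enc :: "'a stack_symbol \<Rightarrow> 'b stack_symbol" where
  "enc x = (if x = Bottom then Bottom else if x = Top then Top else Other (to_nat_on symbols x))"

definition conf ::
  "'i \<Rightarrow> 'j \<Rightarrow> 'a list \<Rightarrow> (nat, 'a stack_symbol, 'a stack_symbol) config \<Rightarrow>
   (nat, 'b stack_symbol, 'b stack_symbol) config" where
  "conf i j buf C = (case C of (q, cs, ps) \<Rightarrow> (state (i, q, j, buf), map enc cs, map enc ps))"

definition check_symbols :: "'b stack_symbol set" where
  "check_symbols = {Bottom, Top, Padding} \<union> Letter ` B \<union> (\<Union>i\<in>I. enc ` check_alphabet (M i))"

definition push_symbols :: "'b stack_symbol set" where
  "push_symbols = {Bottom, Padding} \<union> Letter ` B \<union> (\<Union>i\<in>I. enc ` push_alphabet (M i))"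

text \<open>One formula covers both kinds of rules: a reading rule of \<open>M i\<close> takes its
  letter from the front of the buffer, a non-reading rule leaves the buffer alone.\<close>

definition simulating_rule where
  "simulating_rule i j buf r =
     \<lparr>src = state (i, src r, j, letter_word (letter r) @ buf), letter = None,
      ck_sym = map_option enc (ck_sym r), pd_sym = map_option enc (pd_sym r),
      act = map_stack_action enc (act r), tgt = state (i, tgt r, j, buf)\<rparr>"

text \<open>Loading must be possible whatever the head sees, hence a rule for each pair of symbols.
  The check symbol may be absent, but a pushdown symbol is demanded, so that no letter is read in
  the first step of the second stage.\<close>

definition loading_rule where
  "loading_rule i q j b c p =
     \<lparr>src = state (i, q, j, []), letter = Some b, ck_sym = c, pd_sym = Some p, act = Stay,
      tgt = state (i, q, \<delta> j b, out i j b)\<rparr>"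

text \<open>
  An idle rule never applies, since an empty pushdown stack leaves the head below the check stack;
  it only prevents a state without proper rules from being reading, hence accepting.
\<close>

definition idle_rule :: "nat \<Rightarrow> (nat, 'b, 'b stack_symbol, 'b stack_symbol) rule" where
  "idle_rule s =
     \<lparr>src = s, letter = None, ck_sym = Some Bottom, pd_sym = None, act = Stay, tgt = s\<rparr>"

definition all_states :: "nat set" where
  "all_states = insert 0 (state ` tuples)"

definition pause_states :: "nat set" where
  "pause_states = {state (i, q, j, []) | i q j. i \<in> I \<and> j \<in> J \<and> reading_state (M i) q}"

text \<open>A rule that demands a check symbol on an empty pushdown stack never fires, the head
  being at height \<open>0\<close>. The last premise of \<open>simulate\<close> drops such rules:
  determinism is a condition on rules rather than on configurations, and one of them could clash
  with an idle rule.\<close>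

inductive_set N_rules :: "(nat, 'b, 'b stack_symbol, 'b stack_symbol) rule set" where
  simulate: "simulating_rule i j buf r \<in> N_rules"
    if "i \<in> I" "j \<in> J" "r \<in> rules (M i)" "letter_word (letter r) @ buf \<in> buffers i"
      "pd_sym r = None \<longrightarrow> ck_sym r = None"
| load: "loading_rule i q j b c p \<in> N_rules"
    if "i \<in> I" "j \<in> J" "b \<in> B" "reading_state (M i) q"
      "set_option c \<subseteq> check_symbols" "p \<in> push_symbols"
| idle: "idle_rule s \<in> N_rules" if "s \<in> all_states" "s \<notin> pause_states"

text \<open>
  Every \<open>j\<close> is admitted at the start, not just one: then the entry states are exactly the states
  \<open>state (i, q, j, [])\<close> in which \<open>q\<close> is an entry state of \<open>M i\<close>.
\<close>

definition N :: "(nat, 'b, 'b stack_symbol, 'b stack_symbol) cspda" where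
  "N = \<lparr>states = all_states, input_alphabet = B, check_alphabet = check_symbols,
     push_alphabet = push_symbols, init_state = 0,
     accepting_states = {state (i, q, j, []) | i q j. i \<in> I \<and> j \<in> J \<and> q \<in> accepting_states (M i)},
     init_rules =
       {(0, enc d, state (i, q, j, [])) | i d q j.
          i \<in> I \<and> j \<in> J \<and> (init_state (M i), d, q) \<in> init_rules (M i)} \<union>
       {(state (i, p, j, []), enc d, state (i, q, j, [])) | i p d q j.
          i \<in> I \<and> j \<in> J \<and> (p, d, q) \<in> init_rules (M i)},
     rules = N_rules\<rparr>"

lemma N_simps [simp]:
  "states N = all_states" "input_alphabet N = B" "check_alphabet N = check_symbols"
  "push_alphabet N = push_symbols" "init_state N = 0" "rules N = N_rules"
  "accepting_states N = {state (i, q, j, []) | i q j. i \<in> I \<and> j \<in> J \<and> q \<in> accepting_states (M i)}"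
  "init_rules N = {(0, enc d, state (i, q, j, [])) | i d q j.
          i \<in> I \<and> j \<in> J \<and> (init_state (M i), d, q) \<in> init_rules (M i)} \<union>
       {(state (i, p, j, []), enc d, state (i, q, j, [])) | i p d q j.
          i \<in> I \<and> j \<in> J \<and> (p, d, q) \<in> init_rules (M i)}"
  by (simp_all add: N_def)

section \<open>Well-formedness, reading states and determinism\<close>

lemma is_cspda_M: "i \<in> I \<Longrightarrow> is_cspda (M i)"
  by (rule special_cspdaD(1)[OF special])

lemma rule_M:
  assumes "i \<in> I" "r \<in> rules (M i)"
  shows "src r \<in> states (M i)" "tgt r \<in> states (M i)"
    "set_option (letter r) \<subseteq> input_alphabet (M i)" "set_option (ck_sym r) \<subseteq> check_alphabet (M i)"
    "set_option (pd_sym r) \<subseteq> push_alphabet (M i)" "set_stack_action (act r) \<subseteq> push_alphabet (M i)"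
    "act r = Pop \<Longrightarrow> pd_sym r \<noteq> None"
  using is_cspda_M[OF assms(1)] assms(2) unfolding is_cspda_def by blast+

lemma init_rule_M:
  assumes "i \<in> I" "(p, d, q) \<in> init_rules (M i)"
  shows "p \<in> states (M i)" "d \<in> check_alphabet (M i)" "q \<in> states (M i)"
  using is_cspda_M[OF assms(1)] assms(2) unfolding is_cspda_def by blast+

lemma finite_M:
  assumes "i \<in> I"
  shows "finite (states (M i))" "finite (input_alphabet (M i))" "finite (check_alphabet (M i))"
    "finite (push_alphabet (M i))" "init_state (M i) \<in> states (M i)"
    "accepting_states (M i) \<subseteq> states (M i)"
  using is_cspda_M[OF assms] unfolding is_cspda_def by blast+

lemma finite_tuples: "finite tuples"
  unfolding tuples_def buffers_def
  by (intro finite_SigmaI finite_cartesian_product finite_lists_length_le finite_I finite_J finite_M)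

lemma finite_symbols: "finite symbols"
  unfolding symbols_def using finite_I finite_M by auto

lemma state_eq_iff: "s \<in> tuples \<Longrightarrow> t \<in> tuples \<Longrightarrow> state s = state t \<longleftrightarrow> s = t"
  unfolding state_def
  using inj_on_to_nat_on[OF countable_finite[OF finite_tuples]] by (auto dest: inj_onD)

lemma state_eqD: "state s = state t \<Longrightarrow> s \<in> tuples \<Longrightarrow> t \<in> tuples \<Longrightarrow> s = t"
  by (simp add: state_eq_iff)

lemma state_neq_0 [simp]: "state t \<noteq> 0" "0 \<noteq> state t"
  by (simp_all add: state_def)

lemma inj_on_enc: "inj_on enc symbols"
  unfolding inj_on_def enc_def
  using inj_on_to_nat_on[OF countable_finite[OF finite_symbols]] by (auto dest: inj_onD)

lemma enc_eq_iff [simp]: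
  "enc x = Bottom \<longleftrightarrow> x = Bottom" "Bottom = enc x \<longleftrightarrow> x = Bottom"
  "enc x = Top \<longleftrightarrow> x = Top" "Top = enc x \<longleftrightarrow> x = Top" "enc Bottom = Bottom" "enc Top = Top"
  by (auto simp: enc_def)

lemma alphabet_symbols:
  "i \<in> I \<Longrightarrow> check_alphabet (M i) \<subseteq> symbols" "i \<in> I \<Longrightarrow> push_alphabet (M i) \<subseteq> symbols"
  by (auto simp: symbols_def)

lemma tuples_iff [simp]:
  "(i, q, j, buf) \<in> tuples \<longleftrightarrow> i \<in> I \<and> q \<in> states (M i) \<and> j \<in> J \<and> buf \<in> buffers i"
  by (auto simp: tuples_def)

lemma Nil_in_buffers [simp]: "[] \<in> buffers i"
  by (simp add: buffers_def)

lemma buffers_appendD: "u @ v \<in> buffers i \<Longrightarrow> v \<in> buffers i"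
  by (simp add: buffers_def)

lemma out_in_buffers:
  assumes "i \<in> I" "j \<in> J" "b \<in> B"
  shows "out i j b \<in> buffers i"
proof -
  have "length (out i j b) \<le> max_out"
    unfolding max_out_def
    by (rule Max_ge) (use assms finite_I finite_J finite_B in \<open>auto simp: image_iff\<close>)
  then show ?thesis using out_lists[OF assms] by (auto simp: buffers_def)
qed

lemma reading_state_M: "reading_state (M i) q \<Longrightarrow> q \<in> states (M i)"
  by (simp add: reading_state_def)

lemma finite_alphabets: "finite check_symbols" "finite push_symbols"
  unfolding check_symbols_def push_symbols_def using finite_I finite_B finite_M by auto

lemma N_rulesE:
  assumes "r \<in> N_rules"
  obtains (simulate) i j buf r0 where "i \<in> I" "j \<in> J" "r0 \<in> rules (M i)"
      "letter_word (letter r0) @ buf \<in> buffers i" "buf \<in> buffers i"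
      "pd_sym r0 = None \<longrightarrow> ck_sym r0 = None"
      "r = simulating_rule i j buf r0"
    | (load) i q j b c p where "i \<in> I" "j \<in> J" "b \<in> B" "reading_state (M i) q"
      "q \<in> states (M i)" "set_option c \<subseteq> check_symbols" "p \<in> push_symbols"
      "r = loading_rule i q j b c p"
    | (idle) s where "s \<in> all_states" "s \<notin> pause_states" "r = idle_rule s"
  using assms
proof (cases rule: N_rules.cases)
  case (simulate i j r0 buf)
  then show thesis using that(1)[of i j r0 buf] buffers_appendD by blast
next
  case (load i j b q c p)
  then show thesis using that(2)[of i j b q c p] reading_state_M by blast
next
  case (idle s)
  then show thesis using that(3)[of s] by blast
qed

lemma rule_symbols:
  assumes "i \<in> I" "r \<in> rules (M i)"
  shows "set_option (ck_sym r) \<subseteq> symbols" "set_option (pd_sym r) \<subseteq> symbols"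
  using rule_M(4,5)[OF assms] alphabet_symbols[OF assms(1)] by blast+

lemmas map_option_enc_eqD = map_option_inj_on[OF inj_on_enc, THEN iffD1]

lemma state_in_pause_states_iff:
  assumes "(i, q, j, buf) \<in> tuples"
  shows "state (i, q, j, buf) \<in> pause_states \<longleftrightarrow> buf = [] \<and> reading_state (M i) q"
  using assms unfolding pause_states_def
  by (auto simp: state_eq_iff reading_state_M)

lemma is_cspda_N: "is_cspda N"
proof -
  have "src r \<in> all_states \<and> tgt r \<in> all_states \<and> set_option (letter r) \<subseteq> B \<and>
      set_option (ck_sym r) \<subseteq> check_symbols \<and> set_option (pd_sym r) \<subseteq> push_symbols \<and>
      set_stack_action (act r) \<subseteq> push_symbols \<and> (act r = Pop \<longrightarrow> pd_sym r \<noteq> None)"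
    if "r \<in> N_rules" for r
    using that
  proof (cases rule: N_rulesE)
    case (simulate i j buf r0)
    have "act r0 = Pop" if "map_stack_action enc (act r0) = Pop"
      using that by (cases "act r0") auto
    moreover have "enc ` check_alphabet (M i) \<subseteq> check_symbols" "enc ` push_alphabet (M i) \<subseteq> push_symbols"
      using simulate(1) by (auto simp: check_symbols_def push_symbols_def)
    then have "enc ` set_option (ck_sym r0) \<subseteq> check_symbols" "enc ` set_option (pd_sym r0) \<subseteq> push_symbols"
      "enc ` set_stack_action (act r0) \<subseteq> push_symbols"
      using rule_M(4-6)[OF simulate(1,3)] by blast+
    moreover have "(i, src r0, j, letter_word (letter r0) @ buf) \<in> tuples" "(i, tgt r0, j, buf) \<in> tuples"
      using simulate rule_M(1,2)[OF simulate(1,3)] by simp_all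
    ultimately show ?thesis
      using simulate(7) rule_M(7)[OF simulate(1,3)]
      by (simp add: simulating_rule_def all_states_def option.set_map stack_action.set_map)
  next
    case (load i q j b c p)
    then have "(i, q, j, []) \<in> tuples" "(i, q, \<delta> j b, out i j b) \<in> tuples"
      using out_in_buffers \<delta>_closed by simp_all
    with load show ?thesis
      by (simp add: loading_rule_def all_states_def)
  next
    case (idle s)
    then show ?thesis by (auto simp: idle_rule_def check_symbols_def)
  qed
  then have "\<forall>r\<in>rules N. src r \<in> states N \<and> tgt r \<in> states N \<and>
      set_option (letter r) \<subseteq> input_alphabet N \<and> set_option (ck_sym r) \<subseteq> check_alphabet N \<and>
      set_option (pd_sym r) \<subseteq> push_alphabet N \<and> set_stack_action (act r) \<subseteq> push_alphabet N \<and>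
      (act r = Pop \<longrightarrow> pd_sym r \<noteq> None)"
    unfolding N_simps by blast
  moreover have "accepting_states N \<subseteq> states N"
  proof
    fix s
    assume "s \<in> accepting_states N"
    then obtain i q j where "s = state (i, q, j, [])" "(i, q, j, []) \<in> tuples"
      using finite_M(6) by fastforce
    then show "s \<in> states N" by (auto simp: all_states_def)
  qed
  moreover have "init_rules N \<subseteq> states N \<times> check_alphabet N \<times> states N"
  proof -
    have "state (i, p, j, []) \<in> all_states \<and> enc d \<in> check_symbols \<and> state (i, q, j, []) \<in> all_states"
      if "i \<in> I" "j \<in> J" "(p, d, q) \<in> init_rules (M i)" for i j p d q
      using init_rule_M[OF that(1,3)] that(1,2) by (auto simp: all_states_def check_symbols_def)
    moreover have "0 \<in> all_states" by (simp add: all_states_def)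
    ultimately show ?thesis unfolding N_simps by blast
  qed
  moreover have "finite all_states" "0 \<in> all_states"
    using finite_tuples by (simp_all add: all_states_def)
  ultimately show ?thesis
    using finite_B finite_alphabets unfolding is_cspda_def by (simp only: N_simps)
qed

text \<open>With an empty buffer a simulating rule can only stem from a non-reading rule of
  \<open>M i\<close>, which a reading \<open>q\<close> does not have; so only loading is possible in
  a pause state. Every other state carries an idle rule and is thereby not reading.\<close>

lemma reading_state_N_iff:
  "reading_state N s \<longleftrightarrow> s \<in> pause_states"
proof
  assume s: "reading_state N s"
  show "s \<in> pause_states"
  proof (rule ccontr)
    assume "s \<notin> pause_states"
    then have "idle_rule s \<in> N_rules"
      using s by (intro N_rules.idle) (auto simp: reading_state_def)
    then show False using s by (auto simp: reading_state_def idle_rule_def)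
  qed
next
  assume "s \<in> pause_states"
  then obtain i q j where s: "s = state (i, q, j, [])" "i \<in> I" "j \<in> J" "reading_state (M i) q"
    by (auto simp: pause_states_def)
  then have t: "(i, q, j, []) \<in> tuples" by (simp add: reading_state_M)
  have "p \<noteq> s" if "(p, d, p') \<in> init_rules N" for p d p'
  proof
    assume "p = s"
    with that s(1) obtain i' p0 d0 q' j' where *: "state (i', p0, j', []) = state (i, q, j, [])"
      "i' \<in> I" "j' \<in> J" "(p0, d0, q') \<in> init_rules (M i')"
      by auto
    then have "(i', p0, j', []) = (i, q, j, [])"
      using state_eqD[OF *(1)] t init_rule_M(1) by auto
    then show False using * s(4) by (auto simp: reading_state_def)
  qed
  moreover have "letter r \<noteq> None" if "r \<in> rules N" "src r = s" for r
    using that(1)[simplified]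
  proof (cases rule: N_rulesE)
    case (simulate i' j' buf r0)
    then have "state (i', src r0, j', letter_word (letter r0) @ buf) = state (i, q, j, [])"
      using that(2) s by (simp add: simulating_rule_def)
    then have "(i', src r0, j', letter_word (letter r0) @ buf) = (i, q, j, [])"
      by (rule state_eqD) (use simulate rule_M(1) t in simp_all)
    then show ?thesis using s(4) simulate(3) by (auto simp: reading_state_def)
  next
    case (load i' q' j' b c p)
    then show ?thesis by (simp add: loading_rule_def)
  next
    case (idle s')
    then show ?thesis using that(2) \<open>s \<in> pause_states\<close> by (simp add: idle_rule_def)
  qed
  moreover have "s \<in> states N"
    using s t by (auto simp: all_states_def)
  ultimately show "reading_state N s"
    unfolding reading_state_def by blast
qed

lemma nonreading_state_N:
  assumes "s \<in> states N" "s \<notin> pause_states"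
  shows "nonreading_state N s"
proof -
  have "letter r = None" if "r \<in> N_rules" "src r = s" for r
    using that(1)
  proof (cases rule: N_rulesE)
    case (load i q j b c p)
    then show ?thesis using that(2) assms(2)
      by (auto simp: loading_rule_def pause_states_def)
  qed (simp_all add: simulating_rule_def idle_rule_def)
  then show ?thesis using assms by (auto simp: nonreading_state_def)
qed

text \<open>Whether the source is a pause state separates loading rules from all others. An idle
  rule demands a check symbol on an empty pushdown stack, which no simulating rule does. Two
  simulating rules in conflict come from two rules of \<open>M i\<close> in conflict.\<close>

lemma deterministic_N: "deterministic_second_stage N"
  unfolding deterministic_second_stage_def
proof (intro ballI impI)
  fix r s
  assume rs: "r \<in> rules N" "s \<in> rules N"
    and eq: "src r = src s \<and> ck_sym r = ck_sym s \<and> pd_sym r = pd_sym s \<and>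
        (letter r = letter s \<or> letter r = None \<or> letter s = None)"
  have reading: "src r \<in> pause_states \<longleftrightarrow> letter r \<noteq> None" if "r \<in> rules N" for r
  proof (cases "src r \<in> pause_states")
    case True
    then have "reading_state N (src r)" by (simp add: reading_state_N_iff)
    then have "letter r \<noteq> None" using that unfolding reading_state_def by blast
    then show ?thesis using True by simp
  next
    case False
    then have "nonreading_state N (src r)"
      using that is_cspda_N unfolding is_cspda_def by (blast intro: nonreading_state_N)
    then have "letter r = None" using that unfolding nonreading_state_def by blast
    then show ?thesis using False by simp
  qed
  have src: "src r = src s" and ck: "ck_sym r = ck_sym s" and pd: "pd_sym r = pd_sym s"
    and letters: "letter r = letter s \<or> letter r = None \<or> letter s = None"
    using eq by simp_all
  have letter_None: "letter r = None \<longleftrightarrow> letter s = None"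
    using reading[OF rs(1)] reading[OF rs(2)] src by metis
  show "r = s"
    using rs(1)[simplified]
  proof (cases rule: N_rulesE)
    case r: (simulate i j buf r0)
    from rs(2)[simplified] show ?thesis
    proof (cases rule: N_rulesE)
      case s: (simulate i' j' buf' s0)
      have tup: "(i, src r0, j, letter_word (letter r0) @ buf) =
          (i', src s0, j', letter_word (letter s0) @ buf')"
        by (rule state_eqD) (use src r s rule_M(1) in \<open>simp_all add: simulating_rule_def\<close>)
      then have [simp]: "i' = i" "j' = j" and src0: "src r0 = src s0"
        and words: "letter_word (letter r0) @ buf = letter_word (letter s0) @ buf'"
        by auto
      have "map_option enc (ck_sym r0) = map_option enc (ck_sym s0)"
        "map_option enc (pd_sym r0) = map_option enc (pd_sym s0)"
        using ck pd r(7) s(7) by (simp_all add: simulating_rule_def)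
      then have "ck_sym r0 = ck_sym s0" "pd_sym r0 = pd_sym s0"
        using map_option_enc_eqD[OF rule_symbols(1)[OF r(1,3)] rule_symbols(1)[OF s(1,3)]]
          map_option_enc_eqD[OF rule_symbols(2)[OF r(1,3)] rule_symbols(2)[OF s(1,3)]]
        by (simp_all only:)
      \<comment> \<open>If both rules of \<open>M i\<close> read, both letters are the head of the
        common buffer.\<close>
      moreover have "letter r0 = letter s0 \<or> letter r0 = None \<or> letter s0 = None"
        using words by (cases "letter r0"; cases "letter s0") auto
      moreover have "s0 \<in> rules (M i)" using s(3) by simp
      ultimately have "r0 = s0"
        using special_cspdaD(3)[OF special[OF r(1)], unfolded deterministic_second_stage_def,
            rule_format, OF r(3), of s0] src0 by simp
      then show ?thesis using r(7) s(7) words by simp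
    next
      case (load i' q' j' b c p)
      then show ?thesis using letter_None r(7) by (simp add: simulating_rule_def loading_rule_def)
    next
      case (idle t)
      then show ?thesis using ck pd r(6,7) by (simp add: simulating_rule_def idle_rule_def)
    qed
  next
    case r: (load i q j b c p)
    from rs(2)[simplified] show ?thesis
    proof (cases rule: N_rulesE)
      case (simulate i' j' buf' s0)
      then show ?thesis using letter_None r(8) by (simp add: simulating_rule_def loading_rule_def)
    next
      case s: (load i' q' j' b' c' p')
      have "(i, q, j, [] :: 'a list) = (i', q', j', [])"
        by (rule state_eqD) (use src r s in \<open>simp_all add: loading_rule_def\<close>)
      then show ?thesis using ck pd letters r(8) s(8) by (simp add: loading_rule_def)
    next
      case (idle t)
      then show ?thesis using pd r(8) by (simp add: loading_rule_def idle_rule_def)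
    qed
  next
    case r: (idle t)
    from rs(2)[simplified] show ?thesis
    proof (cases rule: N_rulesE)
      case (simulate i' j' buf' s0)
      then show ?thesis using ck pd r by (simp add: simulating_rule_def idle_rule_def)
    next
      case (load i' q' j' b' c' p')
      then show ?thesis using pd r by (simp add: loading_rule_def idle_rule_def)
    next
      case (idle t')
      then show ?thesis using src r by (simp add: idle_rule_def)
    qed
  qed
qed

section \<open>Correspondence of single steps\<close>

lemma step_N_simulate:
  assumes "i \<in> I" "j \<in> J" "letter_word x @ buf \<in> buffers i" "step (M i) x C D"
  shows "step N None (conf i j (letter_word x @ buf) C) (conf i j buf D)"
  using assms(4)
proof (cases rule: step_elim)
  case (1 r cs ps)
  have "pd_sym r = None \<longrightarrow> ck_sym r = None"
    using 1 by (cases ps) (auto simp: top_symbol_def symbol_at_def)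
  then have "simulating_rule i j buf r \<in> rules N"
    using 1(1,4) assms(1-3) by (auto intro: N_rules.simulate)
  then show ?thesis
    by (rule step_intro[where cs = "map enc cs" and ps = "map enc ps"])
      (use 1 in \<open>simp_all add: simulating_rule_def conf_def symbol_at_map top_symbol_map perform_map\<close>)
qed

lemma step_N_load:
  assumes "i \<in> I" "j \<in> J" "b \<in> B" "well_stacked (M i) C" "bottomed C" "reading_config (M i) C"
  shows "step N (Some b) (conf i j [] C) (conf i (\<delta> j b) (out i j b) C)"
proof -
  obtain q cs g ps where C: "C = (q, cs, g # ps)"
    using assms(5) by (cases C) (auto simp: bottomed_def neq_Nil_conv)
  have "set_option (symbol_at cs (Suc (length ps))) \<subseteq> check_alphabet (M i)" "g \<in> push_alphabet (M i)"
    using assms(4) set_symbol_at[of cs] C by (auto simp: well_stacked_def)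
  then have "loading_rule i q j b (symbol_at (map enc cs) (Suc (length ps))) (enc g) \<in> rules N"
    using assms C unfolding N_simps symbol_at_map
    by (intro N_rules.load)
      (auto simp: reading_config_def check_symbols_def push_symbols_def option.set_map)
  then show ?thesis
    by (rule step_intro) (use C in \<open>simp_all add: loading_rule_def conf_def top_symbol_def\<close>)
qed

text \<open>Injectivity of \<open>state\<close> on \<open>tuples\<close> recovers the tuple,
  injectivity of \<open>enc\<close> on \<open>symbols\<close> recovers what the head of
  \<open>M i\<close> sees, and an idle rule would need a head at height \<open>0\<close> to see a
  check symbol.\<close>

lemma step_N_elim:
  assumes "step N x (conf i j buf C) D'"
    and "i \<in> I" "j \<in> J" "buf \<in> buffers i" "well_stacked (M i) C"
  obtains (simulate) y buf' D where "x = None" "buf = letter_word y @ buf'" "buf' \<in> buffers i"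
      "step (M i) y C D" "D' = conf i j buf' D"
    | (load) b where "b \<in> B" "x = Some b" "buf = []" "reading_config (M i) C"
      "snd (snd C) \<noteq> []" "D' = conf i (\<delta> j b) (out i j b) C"
  using assms(1)
proof (cases rule: step_elim)
  case step: (1 r cs' ps')
  obtain q cs ps where C: "C = (q, cs, ps)" by (cases C)
  then have eqs: "src r = state (i, q, j, buf)" "cs' = map enc cs" "ps' = map enc ps"
    using step by (auto simp: conf_def)
  have tup: "(i, q, j, buf) \<in> tuples" "set cs \<subseteq> check_alphabet (M i)" "set ps \<subseteq> push_alphabet (M i)"
    using assms C by (auto simp: well_stacked_def)
  from step(1)[simplified] show thesis
  proof (cases rule: N_rulesE)
    case sim: (simulate i' j' buf' r0)
    have "(i', src r0, j', letter_word (letter r0) @ buf') = (i, q, j, buf)"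
      by (rule state_eqD) (use sim tup eqs rule_M(1) in \<open>simp_all add: simulating_rule_def\<close>)
    then have [simp]: "i' = i" "j' = j" and src: "src r0 = q"
      and buf: "buf = letter_word (letter r0) @ buf'" by auto
    have r0: "r0 \<in> rules (M i)" using sim by simp
    have "map_option enc (ck_sym r0) = map_option enc (symbol_at cs (length ps))"
      "map_option enc (pd_sym r0) = map_option enc (top_symbol ps)"
      using sim step eqs by (simp_all add: simulating_rule_def symbol_at_map top_symbol_map)
    moreover have "set_option (symbol_at cs (length ps)) \<subseteq> symbols" "set_option (top_symbol ps) \<subseteq> symbols"
      using set_symbol_at[of cs] set_top_symbol[of ps] tup alphabet_symbols[OF assms(2)] by blast+
    ultimately have "ck_sym r0 = symbol_at cs (length ps)" "pd_sym r0 = top_symbol ps"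
      using map_option_enc_eqD[OF rule_symbols(1)[OF assms(2) r0]]
        map_option_enc_eqD[OF rule_symbols(2)[OF assms(2) r0]] by (simp_all only:)
    then have "step (M i) (letter r0) C (tgt r0, cs, perform (act r0) ps)"
      using step.intros[OF r0] C src by simp
    then show thesis
      using simulate[OF _ buf] sim step eqs
      by (simp add: simulating_rule_def conf_def perform_map)
  next
    case ld: (load i' q' j' b c p)
    have "(i', q', j', []) = (i, q, j, buf)"
      by (rule state_eqD) (use ld tup eqs in \<open>simp_all add: loading_rule_def\<close>)
    then have "i' = i" "q' = q" "j' = j" "buf = []" by auto
    moreover have "ps \<noteq> []"
      using ld step eqs by (auto simp: loading_rule_def top_symbol_def)
    ultimately show thesis
      using load ld step eqs C by (simp add: loading_rule_def conf_def reading_config_def)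
  next
    case (idle s)
    then show thesis
      using step eqs by (cases ps) (auto simp: idle_rule_def top_symbol_def symbol_at_def)
  qed
qed

section \<open>The first stage and the entry configurations\<close>

text \<open>The first pushed symbol is accompanied by the choice of \<open>i\<close> and
  \<open>j\<close>, which the first stage then keeps. While the check stack is empty nothing has
  been chosen and the state is \<open>0\<close>; hence the condition
  \<open>cs \<noteq> []\<close>.\<close>

lemma initialises_N_iff:
  "initialises N s cs' \<longleftrightarrow> s = 0 \<and> cs' = [] \<or>
     (\<exists>i q j cs. i \<in> I \<and> j \<in> J \<and> cs \<noteq> [] \<and> initialises (M i) q cs \<and>
        s = state (i, q, j, []) \<and> cs' = map enc cs)" (is "_ \<longleftrightarrow> ?rhs s cs'")
proof
  show "initialises N s cs' \<Longrightarrow> ?rhs s cs'"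
  proof (induction rule: initialises.induct)
    case (init_push s cs' d' s')
    from init_push.hyps(2) consider
        (start) i d q j where "s = 0" "d' = enc d" "s' = state (i, q, j, [])" "i \<in> I" "j \<in> J"
          "(init_state (M i), d, q) \<in> init_rules (M i)"
      | (go) i p d q j where "s = state (i, p, j, [])" "d' = enc d" "s' = state (i, q, j, [])"
          "i \<in> I" "j \<in> J" "(p, d, q) \<in> init_rules (M i)"
      unfolding N_simps by blast
    then show ?case
    proof cases
      case start
      then have "cs' = []" using init_push.IH by auto
      moreover have "initialises (M i) q ([] @ [d])"
        using start initialises.intros by metis
      ultimately show ?thesis using start by force
    next
      case go
      then obtain i' q' j' cs where *: "i' \<in> I" "j' \<in> J" "initialises (M i') q' cs"
        "state (i, p, j, []) = state (i', q', j', [])" "cs' = map enc cs"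
        using init_push.IH by auto
      have "q' \<in> states (M i')"
        using initialises_well_stacked[OF is_cspda_M[OF *(1)] *(3)] by (simp add: well_stacked_def)
      then have "(i, p, j, [] :: 'a list) = (i', q', j', [])"
        by (intro state_eqD[OF *(4)]) (use go init_rule_M(1) * in simp_all)
      then have "initialises (M i) q (cs @ [d])"
        using * go initialises.init_push by auto
      then show ?thesis using go * by force
    qed
  qed simp
next
  have "initialises N (state (i, q, j, [])) (map enc cs)"
    if "initialises (M i) q cs" "i \<in> I" "j \<in> J" "cs \<noteq> []" for i j q cs
    using that
  proof (induction rule: initialises.induct)
    case (init_push q cs d q')
    show ?case
    proof (cases "cs = []")
      case True
      from init_push.hyps(1) True have "q = init_state (M i)"
        by (cases rule: initialises.cases) auto
      then have "(init_state N, enc d, state (i, q', j, [])) \<in> init_rules N"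
        using init_push by auto
      then have "initialises N (state (i, q', j, [])) ([] @ [enc d])"
        by (rule initialises.init_push[OF initialises.init_start])
      then show ?thesis using True by simp
    next
      case False
      moreover have "(state (i, q, j, []), enc d, state (i, q', j, [])) \<in> init_rules N"
        using init_push.hyps(2) init_push.prems unfolding N_simps by blast
      ultimately show ?thesis
        using init_push initialises.init_push by fastforce
    qed
  qed simp
  then show "?rhs s cs' \<Longrightarrow> initialises N s cs'"
    using initialises.init_start[of N] by auto
qed

lemma no_step_from_0: "\<not> step N x (0, cs, ps) D"
proof
  assume "step N x (0, cs, ps) D"
  then show False
  proof (cases rule: step_elim)
    case (1 r cs' ps')
    from 1(1)[simplified] show ?thesis
    proof (cases rule: N_rulesE)
      case (idle s)
      then show ?thesis
        using 1 by (cases ps') (auto simp: idle_rule_def top_symbol_def symbol_at_def)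
    qed (use 1 in \<open>auto simp: simulating_rule_def loading_rule_def\<close>)
  qed
qed

lemma discipline_M:
  assumes "i \<in> I" "initialises (M i) q cs" "step (M i) x (q, cs, []) C"
  obtains mid q' where "cs = Bottom # mid @ [Top]" "Bottom \<notin> set mid" "Top \<notin> set mid" "x = None"
    "C = (q', cs, [Bottom])" "reading_state (M i) q'"
  using special_cspdaD(4)[OF special[OF assms(1)]] assms(2,3) unfolding stack_discipline_def by blast

lemma first_step_M_silent:
  "i \<in> I \<Longrightarrow> initialises (M i) q cs \<Longrightarrow> step (M i) x (q, cs, []) C \<Longrightarrow> x = None"
  by (rule discipline_M)

lemma entry_config_stacked:
  assumes "i \<in> I" "entry_config (M i) C"
  shows "well_stacked (M i) C" "bottomed C"
  using entry_config_well_stacked[OF is_cspda_M] entry_config_bottomed[OF special_cspdaD(4)[OF special]]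
    assms by blast+

lemma step_stacked:
  assumes "i \<in> I" "step (M i) x C D" "well_stacked (M i) C" "bottomed C"
  shows "well_stacked (M i) D" "bottomed D"
  using step_well_stacked[OF is_cspda_M] step_bottomed[OF special_cspdaD(4)[OF special]] assms by blast+

lemma run_stacked:
  assumes "i \<in> I" "run (M i) C w D" "well_stacked (M i) C" "bottomed C"
  shows "well_stacked (M i) D" "bottomed D"
proof -
  have "well_stacked (M i) D \<and> bottomed D"
    using assms(2-4) by (induction rule: run.induct) (use step_stacked[OF assms(1)] in blast)+
  then show "well_stacked (M i) D" "bottomed D" by blast+
qed

lemma first_step_N:
  assumes "initialises N s cs'" "step N x (s, cs', []) C'"
  obtains i j q cs C where "i \<in> I" "j \<in> J" "initialises (M i) q cs" "step (M i) None (q, cs, []) C"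
    "s = state (i, q, j, [])" "cs' = map enc cs" "C' = conf i j [] C" "x = None"
proof -
  have "s \<noteq> 0"
    using assms(2) no_step_from_0[of x cs' "[]" C'] by (cases "s = 0") simp_all
  with assms(1)[unfolded initialises_N_iff]
  have "\<exists>i q j cs. i \<in> I \<and> j \<in> J \<and> initialises (M i) q cs \<and>
      s = state (i, q, j, []) \<and> cs' = map enc cs"
    by auto
  then obtain i q j cs where *: "i \<in> I" "j \<in> J" "initialises (M i) q cs"
      "s = state (i, q, j, [])" "cs' = map enc cs"
    by blast
  have "conf i j [] (q, cs, []) = (s, cs', [])"
    unfolding *(4,5) by (simp add: conf_def)
  then have "step N x (conf i j [] (q, cs, [])) C'"
    using assms(2) by simp
  then show thesis
    using *(1,2) Nil_in_buffers initialises_well_stacked[OF is_cspda_M[OF *(1)] *(3)]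
  proof (cases rule: step_N_elim)
    case (simulate y buf' D)
    then have "y = None" "buf' = []" by simp_all
    then have "step (M i) None (q, cs, []) D" "C' = conf i j [] D"
      using simulate(4,5) by simp_all
    then show thesis
      by (rule that[OF *(1-3) _ *(4,5) _ simulate(1)])
  qed simp_all
qed

lemma entry_config_N_iff:
  "entry_config N C' \<longleftrightarrow> (\<exists>i j C. i \<in> I \<and> j \<in> J \<and> entry_config (M i) C \<and> C' = conf i j [] C)"
proof
  assume "entry_config N C'"
  then obtain s cs' x where "initialises N s cs'" "step N x (s, cs', []) C'"
    unfolding entry_config_def by blast
  then obtain i j q cs C where "i \<in> I" "j \<in> J" "initialises (M i) q cs"
      "step (M i) None (q, cs, []) C" "C' = conf i j [] C"
    by (rule first_step_N)
  then show "\<exists>i j C. i \<in> I \<and> j \<in> J \<and> entry_config (M i) C \<and> C' = conf i j [] C"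
    unfolding entry_config_def by blast
next
  assume "\<exists>i j C. i \<in> I \<and> j \<in> J \<and> entry_config (M i) C \<and> C' = conf i j [] C"
  then obtain i j q cs x C where *: "i \<in> I" "j \<in> J" "initialises (M i) q cs"
      "step (M i) x (q, cs, []) C" "C' = conf i j [] C"
    unfolding entry_config_def by blast
  \<comment> \<open>The check stack of \<open>M i\<close> holds \<open>Bottom\<close> and
    \<open>Top\<close> by now, so the empty stack, on which the two first stages differ, does not
    occur.\<close>
  then have "x = None" "cs \<noteq> []"
    using discipline_M[OF *(1,3,4)] by blast+
  then have "initialises N (state (i, q, j, [])) (map enc cs)"
    using * initialises_N_iff by blast
  moreover have "step N None (state (i, q, j, []), map enc cs, []) C'"
    using step_N_simulate[of i j None "[]" "(q, cs, [])" C] * \<open>x = None\<close> by (simp add: conf_def)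
  ultimately show "entry_config N C'"
    unfolding entry_config_def by blast
qed

lemma fst_conf: "fst (conf i j buf C) = state (i, fst C, j, buf)"
  by (cases C) (simp add: conf_def)

lemma well_stacked_state: "well_stacked M' C \<Longrightarrow> fst C \<in> states M'"
  by (cases C) (simp add: well_stacked_def)

lemma reading_config_conf_iff:
  assumes "i \<in> I" "j \<in> J" "buf \<in> buffers i" "well_stacked (M i) C"
  shows "reading_config N (conf i j buf C) \<longleftrightarrow> buf = [] \<and> reading_config (M i) C"
  unfolding reading_config_def fst_conf reading_state_N_iff
  by (rule state_in_pause_states_iff) (use assms well_stacked_state[OF assms(4)] in simp)

lemma accepting_config_conf_iff:
  assumes "i \<in> I" "j \<in> J" "buf \<in> buffers i" "well_stacked (M i) C"
  shows "accepting_config N (conf i j buf C) \<longleftrightarrow> buf = [] \<and> accepting_config (M i) C"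
proof
  assume "accepting_config N (conf i j buf C)"
  then obtain i' q' j' where *: "i' \<in> I" "j' \<in> J" "q' \<in> accepting_states (M i')"
      "state (i, fst C, j, buf) = state (i', q', j', [])"
    unfolding accepting_config_def fst_conf by auto
  have "(i, fst C, j, buf) = (i', q', j', [])"
    by (rule state_eqD[OF *(4)])
      (use * assms well_stacked_state[OF assms(4)] finite_M(6)[OF *(1)] in auto)
  then show "buf = [] \<and> accepting_config (M i) C"
    using * by (simp add: accepting_config_def)
next
  assume "buf = [] \<and> accepting_config (M i) C"
  then show "accepting_config N (conf i j buf C)"
    using assms unfolding accepting_config_def fst_conf by auto
qed

section \<open>Correspondence of runs\<close>

lemma foldl_closed: "j \<in> J \<Longrightarrow> w \<in> lists B \<Longrightarrow> foldl \<delta> j w \<in> J"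
  by (induction w arbitrary: j) (auto intro: \<delta>_closed)

lemma transduce_lists:
  "i \<in> I \<Longrightarrow> j \<in> J \<Longrightarrow> w \<in> lists B \<Longrightarrow> transduce \<delta> (out i) j w \<in> lists (input_alphabet (M i))"
proof (induction w arbitrary: j)
  case (Cons b w)
  then show ?case using out_lists[of i j b] \<delta>_closed by auto
qed simp

text \<open>Letters are conserved: the old buffer followed by the rewriting of the input read equals
  what \<open>M i\<close> has consumed, \<open>u\<close>, followed by what still waits,
  \<open>buf'\<close>.\<close>

lemma run_N_elim:
  assumes "run N (conf i j buf C) w D'"
    and "i \<in> I" "j \<in> J" "buf \<in> buffers i" "well_stacked (M i) C" "bottomed C"
  obtains u buf' D where "w \<in> lists B" "run (M i) C u D"
    "buf @ transduce \<delta> (out i) j w = u @ buf'" "buf' \<in> buffers i"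
    "D' = conf i (foldl \<delta> j w) buf' D"
proof -
  have "run N C' w D' \<Longrightarrow> C' = conf i j buf C \<Longrightarrow> j \<in> J \<Longrightarrow> buf \<in> buffers i \<Longrightarrow>
      well_stacked (M i) C \<Longrightarrow> bottomed C \<Longrightarrow>
      \<exists>u buf' D. w \<in> lists B \<and> run (M i) C u D \<and> buf @ transduce \<delta> (out i) j w = u @ buf' \<and>
        buf' \<in> buffers i \<and> D' = conf i (foldl \<delta> j w) buf' D" for C'
  proof (induction arbitrary: j buf C rule: run.induct)
    case (run_refl C')
    then show ?case
      by (intro exI[of _ "[]"] exI[of _ buf] exI[of _ C]) (auto intro: run.run_refl)
  next
    case (run_silent C' C'' w E)
    have "step N None (conf i j buf C) C''"
      using run_silent.hyps(1) run_silent.prems(1) by simp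
    then show ?case
      using assms(2) run_silent.prems(2-4)
    proof (cases rule: step_N_elim)
      case (simulate y buf1 D1)
      then obtain u buf' D where *: "w \<in> lists B" "run (M i) D1 u D"
          "buf1 @ transduce \<delta> (out i) j w = u @ buf'" "buf' \<in> buffers i" "E = conf i (foldl \<delta> j w) buf' D"
        using run_silent.IH[OF simulate(5) run_silent.prems(2) simulate(3)]
          step_stacked[OF assms(2) simulate(4) run_silent.prems(4,5)] by blast
      then show ?thesis
        using run_step[OF simulate(4) *(2)] simulate(2)
        by (intro exI[of _ "letter_word y @ u"] exI[of _ buf'] exI[of _ D]) simp
    qed simp
  next
    case (run_read b C' C'' w E)
    have "step N (Some b) (conf i j buf C) C''"
      using run_read.hyps(1) run_read.prems(1) by simp
    then show ?case
      using assms(2) run_read.prems(2-4)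
    proof (cases rule: step_N_elim)
      case (load b')
      then have b: "b' = b" "b \<in> B" by simp_all
      obtain u buf' D where *: "w \<in> lists B" "run (M i) C u D"
          "out i j b @ transduce \<delta> (out i) (\<delta> j b) w = u @ buf'" "buf' \<in> buffers i"
          "E = conf i (foldl \<delta> (\<delta> j b) w) buf' D"
        using run_read.IH[OF load(6)[unfolded b] \<delta>_closed out_in_buffers run_read.prems(4,5)]
          run_read.prems(2) b(2) assms(2) by blast
      then show ?thesis
        using load b by (intro exI[of _ u] exI[of _ buf'] exI[of _ D]) simp
    qed simp
  qed
  then show thesis using assms that by blast
qed

lemma arrives_N_elim:
  assumes "arrives N (conf i j [] C) w D'"
    and "i \<in> I" "j \<in> J" "well_stacked (M i) C" "bottomed C"
  obtains D where "w \<in> lists B" "arrives (M i) C (transduce \<delta> (out i) j w) D"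
    "D' = conf i (foldl \<delta> j w) [] D"
proof -
  have "run N (conf i j [] C) w D'" using assms(1) by (simp add: arrives_def)
  then obtain u buf' D where *: "w \<in> lists B" "run (M i) C u D"
    "[] @ transduce \<delta> (out i) j w = u @ buf'" "buf' \<in> buffers i"
    "D' = conf i (foldl \<delta> j w) buf' D"
    by (rule run_N_elim[OF _ assms(2,3) Nil_in_buffers assms(4,5)])
  moreover have "reading_config N D'" using assms by (simp add: arrives_def)
  ultimately have "buf' = []" "reading_config (M i) D"
    using reading_config_conf_iff[OF assms(2) foldl_closed[OF assms(3) *(1)] *(4)]
      run_stacked(1)[OF assms(2) *(2) assms(4,5)] by auto
  then show thesis using * that unfolding arrives_def by simp
qed

lemma run_N_buffer:
  assumes "i \<in> I" "j \<in> J"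
  shows "run (M i) C u D \<Longrightarrow> u @ buf \<in> buffers i \<Longrightarrow> run N (conf i j (u @ buf) C) [] (conf i j buf D)"
proof (induction rule: run.induct)
  case (run_silent C C' w D)
  have "step N None (conf i j (w @ buf) C) (conf i j (w @ buf) C')"
    using step_N_simulate[OF assms, of None "w @ buf" C C'] run_silent by simp
  then show ?case
    using run_silent by (blast intro: run.run_silent)
next
  case (run_read a C C' w D)
  have "step N None (conf i j ((a # w) @ buf) C) (conf i j (w @ buf) C')"
    using step_N_simulate[OF assms, of "Some a" "w @ buf" C C'] run_read by simp
  moreover have "w @ buf \<in> buffers i"
    using run_read buffers_appendD[of "[a]" "w @ buf"] by simp
  ultimately show ?case
    using run_read by (blast intro: run.run_silent)
qed (simp add: run.run_refl)

text \<open>A letter is loaded only with an empty buffer and in a reading state of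
  \<open>M i\<close>. The run of \<open>M i\<close> is therefore cut at the border of each rewritten
  letter, where \<open>arrives_split\<close> supplies a reading configuration. The buffer is
  arbitrary because the induction continues with a freshly loaded one.\<close>

lemma arrives_N_intro:
  assumes "i \<in> I"
  shows "arrives (M i) C (buf @ transduce \<delta> (out i) j w) D \<Longrightarrow> w \<in> lists B \<Longrightarrow> j \<in> J \<Longrightarrow>
    buf \<in> buffers i \<Longrightarrow> well_stacked (M i) C \<Longrightarrow> bottomed C \<Longrightarrow>
    arrives N (conf i j buf C) w (conf i (foldl \<delta> j w) [] D)"
proof (induction w arbitrary: j buf C)
  case Nil
  then have "run (M i) C buf D" "reading_config (M i) D" by (simp_all add: arrives_def)
  then show ?case
    using run_N_buffer[OF assms Nil(3), of C buf D "[]"] Nil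
      run_stacked(1)[OF assms, of C buf D] reading_config_conf_iff[OF assms Nil(3), of "[]" D]
    by (simp add: arrives_def)
next
  case (Cons b w)
  have "arrives (M i) C (buf @ transduce \<delta> (out i) j (b # w)) D" by (rule Cons.prems(1))
  then obtain E where E: "arrives (M i) C buf E"
      "arrives (M i) E (out i j b @ transduce \<delta> (out i) (\<delta> j b) w) D"
    unfolding transduce.simps by (rule arrives_split[OF special[OF assms]])
  have b: "b \<in> B" "w \<in> lists B" using Cons.prems(2) by auto
  have stacked: "well_stacked (M i) E" "bottomed E"
    using run_stacked[OF assms] E(1) Cons.prems(5,6) unfolding arrives_def by blast+
  have "run N (conf i j buf C) [] (conf i j [] E)"
    using run_N_buffer[OF assms Cons.prems(3), of C buf E "[]"] E(1) Cons.prems(4)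
    by (simp add: arrives_def)
  moreover have "step N (Some b) (conf i j [] E) (conf i (\<delta> j b) (out i j b) E)"
    using step_N_load[OF assms Cons.prems(3) b(1) stacked] E(1) by (simp add: arrives_def)
  moreover have "arrives N (conf i (\<delta> j b) (out i j b) E) w (conf i (foldl \<delta> (\<delta> j b) w) [] D)"
    using Cons.IH[OF E(2) b(2) \<delta>_closed[OF Cons.prems(3) b(1)]
        out_in_buffers[OF assms Cons.prems(3) b(1)] stacked] .
  ultimately have "run N (conf i j buf C) ([] @ b # w) (conf i (foldl \<delta> (\<delta> j b) w) [] D)"
      "reading_config N (conf i (foldl \<delta> (\<delta> j b) w) [] D)"
    unfolding arrives_def by (blast intro: run_append run.run_read)+
  then show ?case by (simp add: arrives_def)
qed

lemma accepting_reading_M: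
  "i \<in> I \<Longrightarrow> accepting_config (M i) C \<Longrightarrow> reading_config (M i) C"
  using special_cspdaD(7)[OF special] by (auto simp: accepting_config_def reading_config_def)

lemma accepting_N_elim:
  assumes "run N (conf i j [] C) w D'" "accepting_config N D'"
    and "i \<in> I" "j \<in> J" "well_stacked (M i) C" "bottomed C"
  obtains D where "w \<in> lists B" "run (M i) C (transduce \<delta> (out i) j w) D" "accepting_config (M i) D"
proof -
  obtain u buf' D where *: "w \<in> lists B" "run (M i) C u D"
    "[] @ transduce \<delta> (out i) j w = u @ buf'" "buf' \<in> buffers i"
    "D' = conf i (foldl \<delta> j w) buf' D"
    by (rule run_N_elim[OF assms(1,3,4) Nil_in_buffers assms(5,6)])
  then have "buf' = []" "accepting_config (M i) D"
    using accepting_config_conf_iff[OF assms(3) foldl_closed[OF assms(4) *(1)] *(4)] assms(2)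
      run_stacked(1)[OF assms(3) *(2) assms(5,6)] by auto
  then show thesis using * that by simp
qed

section \<open>The accepted language\<close>

definition L :: "'b list set" where
  "L = {w \<in> lists B. \<exists>i\<in>I. \<exists>j\<in>J. transduce \<delta> (out i) j w \<in> language (M i)}"

text \<open>A run without steps counts in \<open>language\<close>, so an accepting state in the
  first stage would make the empty word accepted. Acceptance thus always happens after an entry
  configuration.\<close>

lemma initialised_not_accepting:
  assumes "i \<in> I" "initialises (M i) q cs"
  shows "q \<notin> accepting_states (M i)"
  using Nil_rejected[OF assms(1)] assms(2) run.run_refl[of "M i" "(q, cs, [])"]
  unfolding language_def accepting_config_def by force

lemma language_M_iff:
  assumes "i \<in> I"
  shows "w \<in> language (M i) \<longleftrightarrow> w \<in> lists (input_alphabet (M i)) \<and>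
    (\<exists>C D. entry_config (M i) C \<and> run (M i) C w D \<and> accepting_config (M i) D)"
proof
  assume w: "w \<in> language (M i)"
  then obtain q cs C where *: "initialises (M i) q cs" "run (M i) (q, cs, []) w C"
    "accepting_config (M i) C"
    unfolding language_def by blast
  have "C \<noteq> (q, cs, [])"
    using *(3) initialised_not_accepting[OF assms *(1)] by (auto simp: accepting_config_def)
  with run_from_start[OF *(2)] obtain x D v where "step (M i) x (q, cs, []) D" "run (M i) D v C"
      "w = letter_word x @ v"
    by blast
  moreover from this have "x = None" using first_step_M_silent[OF assms *(1)] by blast
  ultimately have "entry_config (M i) D" "run (M i) D w C"
    using *(1) unfolding entry_config_def by auto
  then show "w \<in> lists (input_alphabet (M i)) \<and>
    (\<exists>C D. entry_config (M i) C \<and> run (M i) C w D \<and> accepting_config (M i) D)"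
    using w *(3) unfolding language_def by blast
next
  assume "w \<in> lists (input_alphabet (M i)) \<and>
    (\<exists>C D. entry_config (M i) C \<and> run (M i) C w D \<and> accepting_config (M i) D)"
  then obtain q cs x C D where *: "w \<in> lists (input_alphabet (M i))" "initialises (M i) q cs"
      "step (M i) x (q, cs, []) C" "run (M i) C w D" "accepting_config (M i) D"
    unfolding entry_config_def by blast
  have "x = None" by (rule first_step_M_silent[OF assms *(2,3)])
  then have "run (M i) (q, cs, []) w D" using *(3,4) by (auto intro: run.run_silent)
  then show "w \<in> language (M i)" using * unfolding language_def by blast
qed

lemma language_N: "language N = L"
proof (intro subset_antisym subsetI)
  fix w
  assume w: "w \<in> language N"
  then obtain s cs' C' where *: "initialises N s cs'" "run N (s, cs', []) w C'" "accepting_config N C'"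
    unfolding language_def by blast
  from run_from_start[OF *(2)] consider "C' = (s, cs', [])"
    | x D v where "step N x (s, cs', []) D" "run N D v C'" "w = letter_word x @ v" by blast
  then show "w \<in> L"
  proof cases
    case 1
    then obtain i q j where "i \<in> I" "j \<in> J" "s = state (i, q, j, [])" "q \<in> accepting_states (M i)"
      using *(3) by (auto simp: accepting_config_def)
    moreover from this obtain i' q' j' cs where "i' \<in> I" "j' \<in> J" "initialises (M i') q' cs"
        "s = state (i', q', j', [])"
      using *(1) unfolding initialises_N_iff by auto
    moreover from this have "q' \<in> states (M i')"
      using initialises_well_stacked[OF is_cspda_M, of i' q' cs] by (simp add: well_stacked_def)
    ultimately have "(i, q, j, [] :: 'a list) = (i', q', j', [])"
      using finite_M(6)[of i] by (intro state_eqD) auto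
    then show ?thesis
      using initialised_not_accepting \<open>i' \<in> I\<close> \<open>initialises (M i') q' cs\<close> \<open>q \<in> accepting_states (M i)\<close>
      by blast
  next
    case (2 x D v)
    obtain i j q cs C where C: "i \<in> I" "j \<in> J" "initialises (M i) q cs" "step (M i) None (q, cs, []) C"
      "D = conf i j [] C" "x = None"
      by (rule first_step_N[OF *(1) 2(1)])
    then have entry: "entry_config (M i) C" unfolding entry_config_def by blast
    obtain E where "w \<in> lists B" "run (M i) C (transduce \<delta> (out i) j w) E" "accepting_config (M i) E"
      by (rule accepting_N_elim[OF _ *(3) C(1,2) entry_config_stacked[OF C(1) entry], of w])
        (use 2 C in simp_all)
    then show ?thesis
      using C entry language_M_iff[OF C(1)] transduce_lists unfolding L_def by blast
  qed
next
  fix w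
  assume "w \<in> L"
  then obtain i j where *: "w \<in> lists B" "i \<in> I" "j \<in> J" "transduce \<delta> (out i) j w \<in> language (M i)"
    unfolding L_def by blast
  then obtain C D where CD: "entry_config (M i) C" "run (M i) C (transduce \<delta> (out i) j w) D"
      "accepting_config (M i) D"
      using language_M_iff[OF *(2)] by blast
  have st: "well_stacked (M i) C" "bottomed C" using entry_config_stacked[OF *(2) CD(1)] .
  have "arrives N (conf i j [] C) w (conf i (foldl \<delta> j w) [] D)"
    by (rule arrives_N_intro[OF *(2)])
      (use CD * st accepting_reading_M in \<open>simp_all add: arrives_def\<close>)
  then have run: "run N (conf i j [] C) w (conf i (foldl \<delta> j w) [] D)" by (simp add: arrives_def)
  have acc: "accepting_config N (conf i (foldl \<delta> j w) [] D)"
    using accepting_config_conf_iff[OF *(2) foldl_closed[OF *(3,1)], of "[]" D]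
      run_stacked(1)[OF *(2) CD(2) st] CD(3) by simp
  have "entry_config N (conf i j [] C)" using entry_config_N_iff * CD(1) by blast
  then obtain s cs' x where s: "initialises N s cs'" "step N x (s, cs', []) (conf i j [] C)"
    unfolding entry_config_def by blast
  then have "x = None" by (rule first_step_N)
  then have "run N (s, cs', []) w (conf i (foldl \<delta> j w) [] D)"
    using s run by (auto intro: run.run_silent)
  then show "w \<in> language N"
    using s acc *(1) unfolding language_def N_simps by blast
qed

section \<open>Stack discipline, entry states and accepting states\<close>

lemma stack_discipline_N: "stack_discipline N"
proof -
  have first: "(\<exists>mid. cs' = Bottom # mid @ [Top] \<and> Bottom \<notin> set mid \<and> Top \<notin> set mid) \<and>
      x = None \<and> (\<exists>q'. C' = (q', cs', [Bottom]) \<and> reading_state N q')"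
    if init: "initialises N s cs'" and st: "step N x (s, cs', []) C'" for s cs' x C'
  proof -
    obtain i j q cs C where *: "i \<in> I" "j \<in> J" "initialises (M i) q cs" "step (M i) None (q, cs, []) C"
      "s = state (i, q, j, [])" "cs' = map enc cs" "C' = conf i j [] C" "x = None"
      by (rule first_step_N[OF init st])
    obtain mid q' where M: "cs = Bottom # mid @ [Top]" "Bottom \<notin> set mid" "Top \<notin> set mid"
      "C = (q', cs, [Bottom])" "reading_state (M i) q'"
      by (rule discipline_M[OF *(1,3,4)])
    have "state (i, q', j, []) \<in> pause_states"
      using *(1,2) M(5) unfolding pause_states_def by blast
    moreover have "C' = (state (i, q', j, []), cs', [Bottom])"
      using *(6,7) M(4) by (simp add: conf_def)
    ultimately have "\<exists>q'. C' = (q', cs', [Bottom]) \<and> reading_state N q'"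
      unfolding reading_state_N_iff by blast
    moreover have "cs' = Bottom # map enc mid @ [Top] \<and> Bottom \<notin> set (map enc mid) \<and> Top \<notin> set (map enc mid)"
      using *(6) M(1-3) by auto
    ultimately show ?thesis using *(8) by blast
  qed
  have rule_ok: "(act r = Pop \<longrightarrow> pd_sym r \<noteq> Some Bottom) \<and> (act r = Push Bottom \<longrightarrow> pd_sym r = None) \<and>
      act r \<noteq> Push Top \<and> (ck_sym r = Some Top \<longrightarrow> (\<forall>g. act r \<noteq> Push g))" if "r \<in> N_rules" for r
    using that
  proof (cases rule: N_rulesE)
    case (simulate i j buf r0)
    have r0: "act r0 = Pop \<Longrightarrow> pd_sym r0 \<noteq> Some Bottom" "act r0 = Push Bottom \<Longrightarrow> pd_sym r0 = None"
        "act r0 \<noteq> Push Top" "ck_sym r0 = Some Top \<Longrightarrow> act r0 \<noteq> Push g" for g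
      using special_cspdaD(4)[OF special[OF simulate(1)]] simulate(3)
      unfolding stack_discipline_def by blast+
    \<comment> \<open>\<open>enc\<close> preserves and reflects the two symbols named in the
      discipline, so each clause passes over from the simulated rule.\<close>
    have [simp]: "map_option enc x = Some Bottom \<longleftrightarrow> x = Some Bottom"
      "map_option enc x = Some Top \<longleftrightarrow> x = Some Top" for x
      by (cases x; simp)+
    show ?thesis
      unfolding simulate(7) simulating_rule_def
      using r0 by (cases "act r0") auto
  qed (simp_all add: loading_rule_def idle_rule_def)
  have "{Bottom, Top, Padding} \<subseteq> check_symbols" "{Bottom, Padding} \<subseteq> push_symbols"
    by (simp_all add: check_symbols_def push_symbols_def)
  then show ?thesis
    unfolding stack_discipline_def using first rule_ok by simp
qed

lemma entry_state_N_iff: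
  "entry_state N s \<longleftrightarrow> (\<exists>i q j. i \<in> I \<and> j \<in> J \<and> entry_state (M i) q \<and> s = state (i, q, j, []))"
  unfolding entry_state_def entry_config_N_iff using fst_conf by metis

lemma accepting_states_N: "accepting_states N = {q. reading_state N q \<and> \<not> entry_state N q}"
proof (intro subset_antisym subsetI)
  fix s
  assume "s \<in> accepting_states N"
  then obtain i q j where *: "s = state (i, q, j, [])" "i \<in> I" "j \<in> J" "q \<in> accepting_states (M i)"
    by auto
  then have q: "reading_state (M i) q" "\<not> entry_state (M i) q"
    using special_cspdaD(7)[OF special] by auto
  have "\<not> entry_state N s"
  proof
    assume "entry_state N s"
    then obtain i' q' j' where e: "i' \<in> I" "j' \<in> J" "entry_state (M i') q'" "s = state (i', q', j', [])"
      unfolding entry_state_N_iff by blast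
    have "q' \<in> states (M i')"
      using e(3) well_stacked_state[OF entry_config_stacked(1)[OF e(1)]]
      unfolding entry_state_def by blast
    then have "(i, q, j, [] :: 'a list) = (i', q', j', [])"
      using * e q reading_state_M by (intro state_eqD) simp_all
    then show False using q e(3) by simp
  qed
  then show "s \<in> {q. reading_state N q \<and> \<not> entry_state N q}"
    using * q unfolding reading_state_N_iff pause_states_def by blast
next
  fix s
  assume "s \<in> {q. reading_state N q \<and> \<not> entry_state N q}"
  then obtain i q j where *: "s = state (i, q, j, [])" "i \<in> I" "j \<in> J" "reading_state (M i) q"
      and "\<not> entry_state N s"
    unfolding reading_state_N_iff pause_states_def by blast
  then have "\<not> entry_state (M i) q" unfolding entry_state_N_iff by blast
  then have "q \<in> accepting_states (M i)" using special_cspdaD(7)[OF special] * by blast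
  then show "s \<in> accepting_states N" using * by auto
qed

section \<open>Termination of silent runs, and return after rejected words\<close>

lemma no_infinite_silent_run_M:
  assumes "i \<in> I" "entry_config (M i) C" "run (M i) C w (g 0)"
  shows "\<exists>n. \<not> step (M i) None (g n) (g (Suc n))"
proof -
  obtain q cs x where *: "initialises (M i) q cs" "step (M i) x (q, cs, []) C"
    using assms(2) unfolding entry_config_def by blast
  then have "x = None" by (rule first_step_M_silent[OF assms(1)])
  then have "run (M i) (q, cs, []) w (g 0)"
    using *(2) assms(3) by (auto intro: run.run_silent)
  then show ?thesis
    using special_cspdaD(5)[OF special[OF assms(1)]] *(1)
    unfolding silent_terminating_def by metis
qed

text \<open>A silent step of \<open>N\<close> either follows a silent step of \<open>M i\<close> or shortens the buffer.\<close>

lemma no_infinite_silent_run_N: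
  assumes "i \<in> I" "j \<in> J" "entry_config (M i) C"
  shows "run (M i) C u D \<Longrightarrow> buf \<in> buffers i \<Longrightarrow> f 0 = conf i j buf D \<Longrightarrow>
    \<exists>n. \<not> step N None (f n) (f (Suc n))"
proof (induction buf arbitrary: f u D rule: length_induct)
  case (1 buf)
  show ?case
  proof (rule ccontr)
    assume "\<nexists>n. \<not> step N None (f n) (f (Suc n))"
    then have steps: "step N None (f n) (f (Suc n))" for n by blast
    have C: "well_stacked (M i) C" "bottomed C"
      using entry_config_stacked[OF assms(1,3)] .
    let ?P = "\<lambda>n E. f n = conf i j buf E \<and> (\<exists>u. run (M i) C u E)"
    have "\<exists>g. \<forall>n. ?P n (g n) \<and> (g 0 = D) \<and> step (M i) None (g n) (g (Suc n))"
    proof -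
      \<comment> \<open>As long as the buffer does not shrink, each \<open>f n\<close> is the copy
        of a configuration of \<open>M i\<close> with buffer \<open>buf\<close>. Choosing these one
        after the other from \<open>D\<close> on gives an infinite silent run of
        \<open>M i\<close>.\<close>
      have "\<exists>g. \<forall>n. (?P n (g n) \<and> (n = 0 \<longrightarrow> g n = D)) \<and> step (M i) None (g n) (g (Suc n))"
      proof (rule dependent_nat_choice)
        show "\<exists>E. ?P 0 E \<and> (0 = 0 \<longrightarrow> E = D)" using 1(2,4) by blast
      next
        fix E n
        assume E: "?P n E \<and> (n = 0 \<longrightarrow> E = D)"
        then obtain u' where u': "run (M i) C u' E" by blast
        have "step N None (conf i j buf E) (f (Suc n))" using E steps[of n] by simp
        then show "\<exists>E'. (?P (Suc n) E' \<and> (Suc n = 0 \<longrightarrow> E' = D)) \<and> step (M i) None E E'"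
          using assms(1,2) 1(3) run_stacked(1)[OF assms(1) u' C]
        proof (cases rule: step_N_elim)
          case (simulate y buf' E')
          have run: "run (M i) C (u' @ letter_word y) E'"
            using run_append[OF u' run_step[OF simulate(4) run.run_refl]] by simp
          show ?thesis
          proof (cases y)
            case None
            then show ?thesis using simulate run by (intro exI[of _ E']) auto
          next
            case (Some a)
            then have "length buf' < length buf" using simulate(2) by simp
            moreover have "f (Suc n + 0) = conf i j buf' E'" using simulate(5) by simp
            \<comment> \<open>The tail of \<open>f\<close> from here on would be an infinite silent
              run with a shorter buffer, against the induction hypothesis.\<close>
            ultimately have "\<exists>m. \<not> step N None (f (Suc n + m)) (f (Suc n + Suc m))"
              using 1(1)[THEN spec[of _ buf'], THEN mp, THEN spec[of _ "\<lambda>m. f (Suc n + m)"]]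
                run simulate(3) by blast
            then show ?thesis using steps by simp
          qed
        qed simp
      qed
      then show ?thesis by auto
    qed
    then obtain g where "g 0 = D" "\<And>n. step (M i) None (g n) (g (Suc n))" by blast
    then show False using no_infinite_silent_run_M[OF assms(1,3), of u g] 1(2) by simp
  qed
qed

lemma silent_terminating_N: "silent_terminating N"
  unfolding silent_terminating_def
proof (intro allI impI notI)
  fix s cs' w C'
  assume init: "initialises N s cs'" and run: "run N (s, cs', []) w C'"
    and "\<exists>f::nat \<Rightarrow> _. f 0 = C' \<and> (\<forall>n. step N None (f n) (f (Suc n)))"
  then obtain f where f: "f 0 = C'" "\<And>n. step N None (f n) (f (Suc n))" by blast
  have entry: False if e: "entry_config N E'" and r: "run N E' v (g 0)"
    and st: "\<And>n. step N None (g n) (g (Suc n))" for E' v and g :: "nat \<Rightarrow> _"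
  proof -
    obtain i j E where *: "i \<in> I" "j \<in> J" "entry_config (M i) E" "E' = conf i j [] E"
      using e unfolding entry_config_N_iff by blast
    obtain u buf' D where D: "v \<in> lists B" "run (M i) E u D"
        "[] @ transduce \<delta> (out i) j v = u @ buf'" "buf' \<in> buffers i" "g 0 = conf i (foldl \<delta> j v) buf' D"
      by (rule run_N_elim[OF r[unfolded *(4)] *(1,2) Nil_in_buffers entry_config_stacked[OF *(1,3)]])
    then show False
      using no_infinite_silent_run_N[OF *(1) foldl_closed[OF *(2) D(1)] *(3) D(2,4), of g] D(5) st
      by blast
  qed
  from run_from_start[OF run] consider "C' = (s, cs', [])"
    | x D v where "step N x (s, cs', []) D" "run N D v C'" by blast
  then show False
  proof cases
    case 1
    \<comment> \<open>The start of the second stage precedes the entry configuration, so the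
      infinite run is considered from its second member on.\<close>
    then have "step N None (s, cs', []) (f 1)" using f(1) f(2)[of 0] by simp
    then have "entry_config N (f 1)" using init unfolding entry_config_def by blast
    then show False
      using entry[of "f 1" "[]" "\<lambda>n. f (Suc n)"] f(2) run.run_refl[of N "f 1"] by simp
  next
    case (2 x D v)
    then have "entry_config N D" using init unfolding entry_config_def by blast
    then show False using entry[of D v f] 2 f by simp
  qed
qed

text \<open>
  The failing configuration of \<open>M i\<close> may occur in the middle of a transduced letter, where \<open>N\<close> is not
  in a reading state; hence failure is pushed forward to the end of the input.
\<close>

lemma trivial_words_return_N:
  assumes return: "\<And>v j. v \<in> lists B \<Longrightarrow> v \<notin> L \<Longrightarrow> j \<in> J \<Longrightarrow> foldl \<delta> j v = j"
  shows "trivial_words_return N"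
  unfolding trivial_words_return_def
proof (intro allI impI ballI)
  fix C' u v
  assume e: "entry_config N C'" and uv: "u \<in> lists (input_alphabet N)" "v \<in> lists (input_alphabet N)"
    and v: "v \<notin> language N"
  obtain i j C where *: "i \<in> I" "j \<in> J" "entry_config (M i) C" "C' = conf i j [] C"
    using e unfolding entry_config_N_iff by blast
  have st: "well_stacked (M i) C" "bottomed C"
    using entry_config_stacked[OF *(1,3)] .
  define k U V where "k = foldl \<delta> j u" and "U = transduce \<delta> (out i) j u"
    and "V = transduce \<delta> (out i) k v"
  have k: "k \<in> J" "foldl \<delta> k v = k"
    using uv v foldl_closed[OF *(2)] return by (simp_all add: k_def language_N)
  have UV: "transduce \<delta> (out i) j (u @ v) = U @ V"
    by (simp add: U_def V_def k_def transduce_append)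
  have "U \<in> lists (input_alphabet (M i))" "V \<in> lists (input_alphabet (M i))" "V \<notin> language (M i)"
    using uv v *(1,2) k transduce_lists unfolding U_def V_def language_N L_def by auto
  then have "(\<exists>D. arrives (M i) C U D \<and> arrives (M i) C (U @ V) D) \<or> fails (M i) C (U @ V)"
    using special_cspdaD(6)[OF special[OF *(1)]] *(3) unfolding trivial_words_return_def by blast
  then show "(\<exists>D. arrives N C' u D \<and> arrives N C' (u @ v) D) \<or> fails N C' (u @ v)"
  proof
    assume "\<exists>D. arrives (M i) C U D \<and> arrives (M i) C (U @ V) D"
    then obtain D where D: "arrives (M i) C U D" "arrives (M i) C (U @ V) D" by blast
    have "arrives N (conf i j [] C) u (conf i (foldl \<delta> j u) [] D)"
      by (rule arrives_N_intro[OF *(1)]) (use D uv * st in \<open>simp_all add: U_def\<close>)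
    moreover have "arrives N (conf i j [] C) (u @ v) (conf i (foldl \<delta> j (u @ v)) [] D)"
      by (rule arrives_N_intro[OF *(1)]) (use D uv * st UV in simp_all)
    \<comment> \<open>\<open>v\<close> fixes the transducer state \<open>k\<close> reached after
      \<open>u\<close>, so both arrivals are at the copy of \<open>D\<close> with the same
      \<open>k\<close>.\<close>
    ultimately show ?thesis using k(2) *(4) unfolding foldl_append k_def[symmetric] by metis
  next
    assume fails: "fails (M i) C (U @ V)"
    \<comment> \<open>Without an arrival there is nothing to show, by the second disjunct of
      \<open>fails\<close>. An arrival of \<open>N\<close> gives one of \<open>M i\<close>, whose
      failure must then be a failing configuration \<open>E\<close> on the way to
      \<open>D\<close>.\<close>
    have "failing_config N D'" if arr: "arrives N C' (u @ v) D'" for D'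
    proof -
      obtain D where D: "u @ v \<in> lists B" "arrives (M i) C (U @ V) D"
          "D' = conf i (foldl \<delta> j (u @ v)) [] D"
        by (rule arrives_N_elim[OF arr[unfolded *(4)] *(1,2) st, unfolded UV])
      let ?k = "foldl \<delta> j (u @ v)"
      have kJ: "?k \<in> J" by (rule foldl_closed[OF *(2) D(1)])
      have stD: "well_stacked (M i) D" "bottomed D"
        using run_stacked[OF *(1) _ st] D(2) unfolding arrives_def by blast+
      obtain x y E where E: "U @ V = x @ y" "run (M i) C x E" "failing_config (M i) E"
        using fails D(2) unfolding fails_def by blast
      have "arrives (M i) E y D"
        using run_unique_suffix[OF special_cspdaD(3)[OF special[OF *(1)]] E(2)] E(1,3) D(2)
        unfolding arrives_def failing_config_def by simp
      then have "failing_config (M i) D" by (rule failing_config_arrives[OF E(3)])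
      then have f: "reading_config (M i) D" "\<not> accepting_config (M i) D"
          "\<And>w F. run (M i) D w F \<Longrightarrow> \<not> accepting_config (M i) F"
        unfolding failing_config_def by blast+
      have "\<not> accepting_config N F'" if r: "run N D' w F'" for w F'
      proof
        assume "accepting_config N F'"
        then obtain F where "run (M i) D (transduce \<delta> (out i) ?k w) F" "accepting_config (M i) F"
          by (rule accepting_N_elim[OF r[unfolded D(3)] _ *(1) kJ stD])
        then show False using f(3) by blast
      qed
      moreover have "reading_config N D'" "\<not> accepting_config N D'"
        using reading_config_conf_iff[OF *(1) kJ Nil_in_buffers stD(1)]
          accepting_config_conf_iff[OF *(1) kJ Nil_in_buffers stD(1)] f(1,2) D(3) by simp_all
      ultimately show ?thesis unfolding failing_config_def by blast
    qed
    then have "fails N C' (u @ v)"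
      unfolding fails_def arrives_def by (metis append_Nil2)
    then show ?thesis ..
  qed
qed

lemma special_ET0L_L:
  assumes "\<And>v j. v \<in> lists B \<Longrightarrow> v \<notin> L \<Longrightarrow> j \<in> J \<Longrightarrow> foldl \<delta> j v = j"
  shows "special_ET0L B L"
proof -
  have "special_cspda N"
    unfolding special_cspda_def
  proof (intro conjI ballI)
    show "reading_state N q \<or> nonreading_state N q" if "q \<in> states N" for q
      using nonreading_state_N[OF that] reading_state_N_iff by blast
    show "reading_state N q" if "q \<in> accepting_states N" for q
      using that accepting_states_N by blast
  qed (rule is_cspda_N deterministic_N stack_discipline_N silent_terminating_N accepting_states_N
      trivial_words_return_N assms; assumption?)+
  moreover have "Letter ` B \<subseteq> check_alphabet N" "Letter ` B \<subseteq> push_alphabet N"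
    by (auto simp: check_symbols_def push_symbols_def)
  ultimately show ?thesis
    unfolding special_ET0L_def using language_N by (intro exI[of _ N]) simp
qed

end

text \<open>The construction restated for languages, the automata being obtained by choice.
  \<open>return\<close> is required for all \<open>j\<close> because each of them may be the
  start.\<close>

theorem special_ET0L_transducer_family:
  assumes "finite I" "finite B" "finite J"
    and special: "\<And>i. i \<in> I \<Longrightarrow> special_ET0L (A i) (La i)"
    and Nil: "\<And>i. i \<in> I \<Longrightarrow> [] \<notin> La i"
    and \<delta>: "\<And>j b. j \<in> J \<Longrightarrow> b \<in> B \<Longrightarrow> \<delta> j b \<in> J"
    and out: "\<And>i j b. i \<in> I \<Longrightarrow> j \<in> J \<Longrightarrow> b \<in> B \<Longrightarrow> out i j b \<in> lists (A i)"
    and L: "L = {w \<in> lists B. \<exists>i\<in>I. \<exists>j\<in>J. transduce \<delta> (out i) j w \<in> La i}"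
    and return: "\<And>v j. v \<in> lists B \<Longrightarrow> v \<notin> L \<Longrightarrow> j \<in> J \<Longrightarrow> foldl \<delta> j v = j"
  shows "special_ET0L B L"
proof -
  have "\<forall>i\<in>I. \<exists>M :: (nat, _, _ stack_symbol, _ stack_symbol) cspda.
      special_cspda M \<and> input_alphabet M = A i \<and> language M = La i"
    using special unfolding special_ET0L_def by blast
  then obtain M :: "_ \<Rightarrow> (nat, _, _ stack_symbol, _ stack_symbol) cspda"
    where M: "\<forall>i\<in>I. special_cspda (M i) \<and> input_alphabet (M i) = A i \<and> language (M i) = La i"
    by (rule bchoice[THEN exE])
  interpret T: transducer_family I M B J \<delta> out
    by unfold_locales (use assms(1-3) Nil \<delta> out M in simp_all)
  have "T.L = L"
    unfolding T.L_def L using M by (metis (no_types, lifting))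
  then show ?thesis using T.special_ET0L_L return by simp
qed

section \<open>An automaton for parity\<close>

context
  fixes x :: 'a
begin

text \<open>The entry state is \<open>3\<close>, the accepting state \<open>4\<close>.\<close>

definition parity_rule ::
  "nat \<Rightarrow> 'a option \<Rightarrow> 'a stack_symbol option \<Rightarrow> 'a stack_symbol stack_action \<Rightarrow> nat \<Rightarrow>
   (nat, 'a, 'a stack_symbol, 'a stack_symbol) rule" where
  "parity_rule p l c k q = \<lparr>src = p, letter = l, ck_sym = c, pd_sym = c, act = k, tgt = q\<rparr>"

definition parity_machine :: "(nat, 'a, 'a stack_symbol, 'a stack_symbol) cspda" where
  "parity_machine = \<lparr>states = {0, 1, 2, 3, 4}, input_alphabet = {x},
     check_alphabet = {Bottom, Top, Padding, Letter x}, push_alphabet = {Bottom, Padding, Letter x},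
     init_state = 0, accepting_states = {4}, init_rules = {(0, Bottom, 1), (1, Top, 2)},
     rules = {parity_rule 2 None None (Push Bottom) 3, parity_rule 3 (Some x) (Some Bottom) Stay 4,
       parity_rule 4 (Some x) (Some Bottom) Stay 3}\<rparr>"

definition parity_config :: "nat \<Rightarrow> (nat, 'a stack_symbol, 'a stack_symbol) config" where
  "parity_config q = (q, [Bottom, Top], [Bottom])"

lemma parity_machine_simps [simp]:
  "states parity_machine = {0, 1, 2, 3, 4}" "input_alphabet parity_machine = {x}"
  "check_alphabet parity_machine = {Bottom, Top, Padding, Letter x}"
  "push_alphabet parity_machine = {Bottom, Padding, Letter x}"
  "init_state parity_machine = 0" "accepting_states parity_machine = {4}"
  "init_rules parity_machine = {(0, Bottom, 1), (1, Top, 2)}"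
  "rules parity_machine = {parity_rule 2 None None (Push Bottom) 3,
     parity_rule 3 (Some x) (Some Bottom) Stay 4, parity_rule 4 (Some x) (Some Bottom) Stay 3}"
  by (simp_all add: parity_machine_def)

lemma parity_rule_simps [simp]:
  "src (parity_rule p l c k q) = p" "letter (parity_rule p l c k q) = l"
  "ck_sym (parity_rule p l c k q) = c" "pd_sym (parity_rule p l c k q) = c"
  "act (parity_rule p l c k q) = k" "tgt (parity_rule p l c k q) = q"
  by (simp_all add: parity_rule_def)

lemma initialises_parity:
  "initialises parity_machine q cs \<longleftrightarrow> (q, cs) \<in> {(0, []), (1, [Bottom]), (2, [Bottom, Top])}"
proof
  show "initialises parity_machine q cs \<Longrightarrow> (q, cs) \<in> {(0, []), (1, [Bottom]), (2, [Bottom, Top])}"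
    by (induction rule: initialises.induct) auto
  have 0: "initialises parity_machine 0 []"
    using initialises.init_start[of parity_machine] by simp
  have 1: "initialises parity_machine 1 [Bottom]"
    using initialises.init_push[OF 0, of Bottom 1] by simp
  have "initialises parity_machine 2 [Bottom, Top]"
    using initialises.init_push[OF 1, of Top 2] by simp
  with 0 1 show "(q, cs) \<in> {(0, []), (1, [Bottom]), (2, [Bottom, Top])} \<Longrightarrow>
      initialises parity_machine q cs" by auto
qed

text \<open>The term \<open>7 - q\<close> exchanges the working states \<open>3\<close> and
  \<open>4\<close>.\<close>

lemma step_parity_iff:
  "step parity_machine y (q, cs, ps) D \<longleftrightarrow>
     q = 2 \<and> ps = [] \<and> y = None \<and> D = (3, cs, [Bottom]) \<or>
     q \<in> {3, 4} \<and> top_symbol ps = Some Bottom \<and> symbol_at cs (length ps) = Some Bottom \<and>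
     y = Some x \<and> D = (7 - q, cs, ps)"
proof
  assume "step parity_machine y (q, cs, ps) D"
  then show "q = 2 \<and> ps = [] \<and> y = None \<and> D = (3, cs, [Bottom]) \<or>
     q \<in> {3, 4} \<and> top_symbol ps = Some Bottom \<and> symbol_at cs (length ps) = Some Bottom \<and>
     y = Some x \<and> D = (7 - q, cs, ps)"
    by (cases rule: step_elim) (auto simp: top_symbol_def split: list.splits)
next
  assume "q = 2 \<and> ps = [] \<and> y = None \<and> D = (3, cs, [Bottom]) \<or>
     q \<in> {3, 4} \<and> top_symbol ps = Some Bottom \<and> symbol_at cs (length ps) = Some Bottom \<and>
     y = Some x \<and> D = (7 - q, cs, ps)"
  then consider "q = 2" "ps = []" "y = None" "D = (3, cs, [Bottom])"
    | "q \<in> {3, 4}" "top_symbol ps = Some Bottom" "symbol_at cs (length ps) = Some Bottom"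
      "y = Some x" "D = (7 - q, cs, ps)" by blast
  then show "step parity_machine y (q, cs, ps) D"
  proof cases
    case 1
    then show ?thesis
      by (intro step_intro[of "parity_rule 2 None None (Push Bottom) 3" _ cs "[]"])
        (simp_all add: symbol_at_def top_symbol_def)
  next
    case 2
    then show ?thesis
      by (intro step_intro[of "parity_rule q (Some x) (Some Bottom) Stay (7 - q)" _ cs ps]) auto
  qed
qed

lemma fst_parity_config [simp]: "fst (parity_config q) = q"
  by (simp add: parity_config_def)

lemma entry_config_parity: "entry_config parity_machine C \<longleftrightarrow> C = parity_config 3"
  unfolding entry_config_def initialises_parity step_parity_iff parity_config_def
  by (auto simp: top_symbol_def)

lemma step_parity_config:
  "q \<in> {3, 4} \<Longrightarrow> step parity_machine y (parity_config q) D \<longleftrightarrow> y = Some x \<and> D = parity_config (7 - q)"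
  unfolding parity_config_def step_parity_iff by (auto simp: top_symbol_def symbol_at_def)

lemma run_parity_iff:
  assumes "q \<in> {3, 4}"
  shows "run parity_machine (parity_config q) w D \<longleftrightarrow>
    w \<in> lists {x} \<and> D = parity_config (if even (length w) then q else 7 - q)"
proof
  have "run parity_machine C w D \<Longrightarrow> q \<in> {3, 4} \<Longrightarrow> C = parity_config q \<Longrightarrow>
    w \<in> lists {x} \<and> D = parity_config (if even (length w) then q else 7 - q)" for C q
  proof (induction arbitrary: q rule: run.induct)
    case (run_silent C C' w E)
    then show ?case using step_parity_config[of q None C'] by simp
  next
    case (run_read a C C' w E)
    then have "a = x" "C' = parity_config (7 - q)"
      using step_parity_config[of q "Some a" C'] by simp_all
    moreover have "7 - q \<in> {3, 4}" "7 - (7 - q) = q" using run_read.prems by auto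
    ultimately show ?case using run_read.IH[of "7 - q"] by auto
  qed simp
  then show "run parity_machine (parity_config q) w D \<Longrightarrow>
    w \<in> lists {x} \<and> D = parity_config (if even (length w) then q else 7 - q)"
    using assms by blast
next
  have "w \<in> lists {x} \<Longrightarrow> q \<in> {3, 4} \<Longrightarrow>
    run parity_machine (parity_config q) w (parity_config (if even (length w) then q else 7 - q))" for q
  proof (induction w arbitrary: q)
    case (Cons a w)
    have q: "7 - q \<in> {3, 4}" "7 - (7 - q) = q" using Cons.prems by auto
    have "step parity_machine (Some x) (parity_config q) (parity_config (7 - q))"
      using step_parity_config[OF Cons.prems(2)] by blast
    moreover have "run parity_machine (parity_config (7 - q)) w
        (parity_config (if even (length w) then 7 - q else q))"
      using Cons.IH[of "7 - q"] Cons.prems(1) q by (cases "even (length w)") simp_all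
    ultimately have "run parity_machine (parity_config q) (x # w)
        (parity_config (if even (length w) then 7 - q else q))"
      by (rule run.run_read)
    then show ?case using Cons.prems(1) by auto
  qed (simp add: run.run_refl)
  then show "w \<in> lists {x} \<and> D = parity_config (if even (length w) then q else 7 - q) \<Longrightarrow>
      run parity_machine (parity_config q) w D"
    using assms by blast
qed

lemma run_parity_start:
  assumes "initialises parity_machine q cs" "run parity_machine (q, cs, []) w D"
  shows "w = [] \<and> D = (q, cs, []) \<or> run parity_machine (parity_config 3) w D"
  using run_from_start[OF assms(2)] assms(1)
  by (auto simp: initialises_parity step_parity_iff parity_config_def top_symbol_def)

lemma reading_state_parity: "reading_state parity_machine q \<longleftrightarrow> q \<in> {3, 4}"
  unfolding reading_state_def by auto

lemma language_parity: "language parity_machine = {w \<in> lists {x}. odd (length w)}"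
proof (intro subset_antisym subsetI)
  fix w
  assume "w \<in> language parity_machine"
  then obtain q cs C where *: "initialises parity_machine q cs" "run parity_machine (q, cs, []) w C"
      "accepting_config parity_machine C"
    unfolding language_def by blast
  have "C \<noteq> (q, cs, [])"
    using *(1,3) by (auto simp: accepting_config_def initialises_parity)
  then have "run parity_machine (parity_config 3) w C"
    using run_parity_start[OF *(1,2)] by blast
  then have "w \<in> lists {x}" "C = parity_config (if even (length w) then 3 else 7 - 3)"
    using run_parity_iff[of 3] by auto
  then show "w \<in> {w \<in> lists {x}. odd (length w)}"
    using *(3) by (auto simp: accepting_config_def)
next
  fix w
  assume w: "w \<in> {w \<in> lists {x}. odd (length w)}"
  then have "run parity_machine (parity_config 3) w (parity_config 4)"
    by (simp add: run_parity_iff)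
  moreover have "step parity_machine None (2, [Bottom, Top], []) (parity_config 3)"
    by (simp add: step_parity_iff parity_config_def)
  ultimately have "run parity_machine (2, [Bottom, Top], []) w (parity_config 4)"
    by (auto intro: run.run_silent)
  moreover have "initialises parity_machine 2 [Bottom, Top]"
    by (simp add: initialises_parity)
  moreover have "accepting_config parity_machine (parity_config 4)"
    by (simp add: accepting_config_def parity_config_def)
  moreover have "w \<in> lists (input_alphabet parity_machine)"
    using w by simp
  ultimately show "w \<in> language parity_machine"
    unfolding language_def by blast
qed

lemma silent_terminating_parity: "silent_terminating parity_machine"
  unfolding silent_terminating_def
proof (intro allI impI notI)
  fix q cs w C
  assume init: "initialises parity_machine q cs" and run: "run parity_machine (q, cs, []) w C"
    and "\<exists>f::nat \<Rightarrow> _. f 0 = C \<and> (\<forall>n. step parity_machine None (f n) (f (Suc n)))"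
  then obtain f where f: "f 0 = C" "\<And>n. step parity_machine None (f n) (f (Suc n))" by blast
  obtain q' cs' ps' where 1: "f 1 = (q', cs', ps')" by (cases "f 1")
  obtain q0 cs0 ps0 where 0: "f 0 = (q0, cs0, ps0)" by (cases "f 0")
  show False
    using f(2)[of 0] f(2)[of 1] 0 1 by (auto simp: step_parity_iff)
qed

text \<open>For (P6): a rejected word has even length, so it exchanges the two working states an
  even number of times. The stacks do not change after entry, hence the whole configuration
  returns.\<close>

lemma special_parity_machine: "special_cspda parity_machine"
proof -
  have "is_cspda parity_machine"
    unfolding is_cspda_def by auto
  moreover have "\<forall>q\<in>states parity_machine.
      reading_state parity_machine q \<or> nonreading_state parity_machine q"
    unfolding reading_state_parity nonreading_state_def by auto
  moreover have "deterministic_second_stage parity_machine"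
    unfolding deterministic_second_stage_def by auto
  moreover have "stack_discipline parity_machine"
    unfolding stack_discipline_def initialises_parity step_parity_iff reading_state_parity
    by (auto simp: top_symbol_def)
  moreover have "entry_state parity_machine q \<longleftrightarrow> q = 3" for q
    unfolding entry_state_def entry_config_parity by (auto simp: parity_config_def)
  moreover have "trivial_words_return parity_machine"
    unfolding trivial_words_return_def
  proof (intro allI impI ballI disjI1)
    fix C u v
    assume *: "entry_config parity_machine C" "u \<in> lists (input_alphabet parity_machine)"
      "v \<in> lists (input_alphabet parity_machine)" "v \<notin> language parity_machine"
    then have "even (length v)" by (auto simp: language_parity)
    then show "\<exists>D. arrives parity_machine C u D \<and> arrives parity_machine C (u @ v) D"
      using * unfolding arrives_def
      by (intro exI[of _ "parity_config (if even (length u) then 3 else 7 - 3)"])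
        (simp add: entry_config_parity run_parity_iff reading_config_def reading_state_parity)
  qed
  ultimately show ?thesis
    unfolding special_cspda_def using silent_terminating_parity reading_state_parity by auto
qed

lemma special_ET0L_parity: "special_ET0L {x} {w \<in> lists {x}. odd (length w)}"
  unfolding special_ET0L_def
  using special_parity_machine language_parity by (intro exI[of _ parity_machine]) simp

end

section \<open>Groups\<close>

lemma word_value_append:
  fixes G (structure)
  assumes "group G" "u \<in> lists (carrier G)" "v \<in> lists (carrier G)"
  shows "word_value G v \<in> carrier G \<and> word_value G (u @ v) = word_value G u \<otimes>\<^bsub>G\<^esub> word_value G v"
proof -
  interpret group G by fact
  have closed: "w \<in> lists (carrier G) \<Longrightarrow> word_value G w \<in> carrier G" for w
    by (induction w) (auto simp: word_value_def)
  have "word_value G (u @ v) = word_value G u \<otimes> word_value G v"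
    using assms(2,3) closed
    by (induction u) (auto simp: word_value_def m_assoc)
  then show ?thesis using closed assms(3) by blast
qed

lemma word_value_simps [simp]:
  "word_value G [] = \<one>\<^bsub>G\<^esub>" "word_value G (a # w) = a \<otimes>\<^bsub>G\<^esub> word_value G w"
  by (simp_all add: word_value_def)

lemma word_exists:
  fixes G (structure)
  assumes "group G" "finite_symmetric_generating_set G A" "g \<in> carrier G"
  shows "\<exists>w\<in>lists A. word_value G w = g"
proof -
  interpret group G by fact
  have A: "A \<subseteq> carrier G" "\<And>a. a \<in> A \<Longrightarrow> inv a \<in> A" "generate G A = carrier G"
    using assms(2) unfolding finite_symmetric_generating_set_def by auto
  have "g \<in> generate G A" using assms(3) A by simp
  then show ?thesis
  proof (induction rule: generate.induct)
    case one
    show ?case by (intro bexI[of _ "[]"]) auto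
  next
    case (incl a)
    then show ?case using A(1) by (intro bexI[of _ "[a]"]) auto
  next
    case (inv a)
    then show ?case using A by (intro bexI[of _ "[inv a]"]) auto
  next
    case (eng g h)
    then obtain u v where uv: "u \<in> lists A" "v \<in> lists A" "word_value G u = g" "word_value G v = h"
      by blast
    then have "word_value G (u @ v) = g \<otimes> h"
      using word_value_append[OF assms(1), of u v] A(1) lists_mono by blast
    then show ?case using uv by (intro bexI[of _ "u @ v"]) auto
  qed
qed

lemma finite_symmetric_generating_set_closure:
  fixes G (structure)
  assumes "group G" "finite S" "S \<subseteq> carrier G" "carrier G \<subseteq> generate G S"
  shows "finite_symmetric_generating_set G (S \<union> (\<lambda>s. inv\<^bsub>G\<^esub> s) ` S)" (is "finite_symmetric_generating_set G ?B")
proof -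
  interpret group G by fact
  have B: "?B \<subseteq> carrier G" using assms(3) by auto
  have "generate G S \<subseteq> generate G ?B" by (rule mono_generate) auto
  then have "generate G ?B = carrier G"
    using assms(4) generate_incl[OF B] by auto
  then show ?thesis
    unfolding finite_symmetric_generating_set_def using assms(2,3) B by auto
qed

section \<open>Accepting co-word problems\<close>

text \<open>Rewriting for \<open>i\<close> turns the value of a word into its image under
  \<open>\<phi> i\<close>, and joint injectivity says that a nontrivial value is seen by some
  \<open>\<phi> i\<close>. With a single transducer state, every word fixes it. All finite
  \<open>B\<close> are treated at once, so a change of generators becomes a special case.\<close>

proposition special_ET0L_coWP_jointly_injective:
  assumes K: "group K" and B: "finite B" "B \<subseteq> carrier K" and I: "finite I"
    and hom: "\<And>i. i \<in> I \<Longrightarrow> group_hom K (G i) (\<phi> i)"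
    and A: "\<And>i. i \<in> I \<Longrightarrow> finite_symmetric_generating_set (G i) (A i)"
    and special: "\<And>i. i \<in> I \<Longrightarrow> special_ET0L (A i) (coWP (G i) (A i))"
    and inj: "\<And>g. g \<in> carrier K \<Longrightarrow> (\<And>i. i \<in> I \<Longrightarrow> \<phi> i g = \<one>\<^bsub>G i\<^esub>) \<Longrightarrow> g = \<one>\<^bsub>K\<^esub>"
  shows "special_ET0L B (coWP K B)"
proof -
  have group: "group (G i)" if "i \<in> I" for i
    using hom[OF that] by (simp add: group_hom_def)
  have "\<exists>w. w \<in> lists (A i) \<and> word_value (G i) w = \<phi> i b" if "i \<in> I" "b \<in> B" for i b
    using word_exists[OF group A] group_hom.hom_closed[OF hom] that B(2) by blast
  then obtain f where f: "\<And>i b. i \<in> I \<Longrightarrow> b \<in> B \<Longrightarrow> f i b \<in> lists (A i) \<and> word_value (G i) (f i b) = \<phi> i b"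
    by metis
  let ?out = "\<lambda>i (_ :: unit). f i" and ?\<delta> = "\<lambda>(_ :: unit) _. ()"
  have closed: "word_value K w \<in> carrier K" if "w \<in> lists B" for w
    using word_value_append[OF K, of "[]" w] that B(2) lists_mono by blast
  have lists: "transduce ?\<delta> (?out i) () w \<in> lists (A i)" if "i \<in> I" "w \<in> lists B" for i w
    using that(2) by induction (use f that(1) in auto)
  have val: "word_value (G i) (transduce ?\<delta> (?out i) () w) = \<phi> i (word_value K w)"
    if "i \<in> I" "w \<in> lists B" for i w
    using that(2)
  proof induction
    case Nil
    then show ?case using group_hom.hom_one[OF hom[OF that(1)]] by simp
  next
    case (Cons b w)
    have "A i \<subseteq> carrier (G i)"
      using A[OF that(1)] by (simp add: finite_symmetric_generating_set_def)
    then have "word_value (G i) (f i b @ transduce ?\<delta> (?out i) () w) =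
        word_value (G i) (f i b) \<otimes>\<^bsub>G i\<^esub> word_value (G i) (transduce ?\<delta> (?out i) () w)"
      using word_value_append[OF group[OF that(1)], of "f i b" "transduce ?\<delta> (?out i) () w"]
        f[OF that(1) Cons.hyps(1)] lists[OF that(1), of w] Cons.hyps(2) lists_mono by blast
    then show ?case
      using Cons f[OF that(1) Cons.hyps(1)] group_hom.hom_mult[OF hom[OF that(1)], of b "word_value K w"]
        closed[of w] B(2) by auto
  qed
  show ?thesis
  proof (rule special_ET0L_transducer_family[where I = I and J = "{()}" and A = A and \<delta> = ?\<delta>
        and out = ?out and La = "\<lambda>i. coWP (G i) (A i)"])
    show "coWP K B = {w \<in> lists B. \<exists>i\<in>I. \<exists>j\<in>{()}. transduce ?\<delta> (?out i) j w \<in> coWP (G i) (A i)}"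
    proof (intro subset_antisym subsetI)
      fix w
      assume w: "w \<in> coWP K B"
      then obtain i where "i \<in> I" "\<phi> i (word_value K w) \<noteq> \<one>\<^bsub>G i\<^esub>"
        using inj[of "word_value K w"] closed[of w] unfolding coWP_def by blast
      then show "w \<in> {w \<in> lists B. \<exists>i\<in>I. \<exists>j\<in>{()}. transduce ?\<delta> (?out i) j w \<in> coWP (G i) (A i)}"
        using w lists[of i w] val[of i w] unfolding coWP_def by auto
    next
      fix w
      assume "w \<in> {w \<in> lists B. \<exists>i\<in>I. \<exists>j\<in>{()}. transduce ?\<delta> (?out i) j w \<in> coWP (G i) (A i)}"
      then obtain i where "w \<in> lists B" "i \<in> I" "transduce ?\<delta> (?out i) () w \<in> coWP (G i) (A i)"
        by blast
      then have "w \<in> lists B" "i \<in> I" "\<phi> i (word_value K w) \<noteq> \<one>\<^bsub>G i\<^esub>"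
        using val[of i w] unfolding coWP_def by simp_all
      then show "w \<in> coWP K B"
        using group_hom.hom_one[OF hom] unfolding coWP_def by auto
    qed
  qed (use assms f in \<open>auto simp: coWP_def\<close>)
qed

text \<open>If the value \<open>g\<close> of a word fixes the coset \<open>c\<close>, the rewritten
  word has the value \<open>rep c \<otimes> g \<otimes> inv (rep c)\<close>, which is trivial only
  if \<open>g\<close> is. If \<open>g\<close> moves \<open>c\<close> to \<open>d\<close>, the
  rewritten value is trivial for \<open>g = inv (rep c) \<otimes> rep d\<close>, a nontrivial
  element; this is the gap closed by the parity automaton.\<close>

proposition special_ET0L_coWP_finite_index:
  fixes G (structure)
  assumes G: "group G" and H: "subgroup H G" and finite: "finite (rcosets\<^bsub>G\<^esub> H)"
    and A: "finite_symmetric_generating_set (G\<lparr>carrier := H\<rparr>) A"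
    and special: "special_ET0L A (coWP (G\<lparr>carrier := H\<rparr>) A)"
    and B: "finite B" "B \<subseteq> carrier G"
  shows "special_ET0L B (coWP G B)"
proof -
  interpret group G by fact
  interpret H: subgroup H G by fact
  let ?H = "G\<lparr>carrier := H\<rparr>"
  have H_group: "group ?H" by (rule H.subgroup_is_group[OF G])
  have word_value_H: "word_value ?H = word_value G" by (simp add: word_value_def fun_eq_iff)
  have AH: "A \<subseteq> H" using A by (simp add: finite_symmetric_generating_set_def)
  define J where "J = rcosets H"
  define rep where "rep c = (SOME g. g \<in> c)" for c :: "'a set"
  have J_sub: "c \<subseteq> carrier G" if "c \<in> J" for c
    using that unfolding J_def by (rule H.rcosets_carrier[OF G])
  have rep: "rep c \<in> carrier G" "H #> rep c = c" if c: "c \<in> J" for c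
  proof -
    obtain g where g: "g \<in> carrier G" "c = H #> g"
      using c unfolding J_def RCOSETS_def by blast
    then have "g \<in> c" using rcos_self[OF _ H] by simp
    then have "rep c \<in> c"
      unfolding rep_def using someI[of "\<lambda>g. g \<in> c" g] by blast
    then show "rep c \<in> carrier G" using J_sub[OF that] by blast
    have "H #> g = H #> rep c"
      using \<open>rep c \<in> c\<close> unfolding g(2) by (rule repr_independence[OF _ g(1) H])
    then show "H #> rep c = c" using g(2) by simp
  qed
  have translate: "c #> g \<in> J" if "c \<in> J" "g \<in> carrier G" for c g
  proof -
    have "c #> g = H #> (rep c \<otimes> g)"
      using rep[OF that(1)] that(2) coset_mult_assoc[of H "rep c" g] H.subset by simp
    moreover have "rep c \<otimes> g \<in> carrier G" using rep(1)[OF that(1)] that(2) by simp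
    ultimately show ?thesis unfolding J_def by (simp add: rcosetsI H.subset)
  qed
  have H_in_J: "H \<in> J"
    unfolding J_def by (rule H.subgroup_in_rcosets[OF G])
  \<comment> \<open>These are the elements of Schreier's method: \<open>rep c \<otimes> b\<close>
    and \<open>rep (c #> b)\<close> represent the same right coset of \<open>H\<close>.\<close>
  let ?h = "\<lambda>c b. rep c \<otimes> b \<otimes> inv (rep (c #> b))"
  have h: "?h c b \<in> H" if "c \<in> J" "b \<in> carrier G" for c b
  proof -
    have "H #> (rep c \<otimes> b) = c #> b"
      using rep[OF that(1)] that(2) coset_mult_assoc[of H "rep c" b] H.subset by simp
    also have "\<dots> = H #> rep (c #> b)"
      by (rule rep(2)[OF translate[OF that], symmetric])
    finally have eq: "H #> (rep c \<otimes> b) = H #> rep (c #> b)" .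
    have "rep c \<otimes> b \<in> H #> rep (c #> b)"
      unfolding eq[symmetric] using rep[OF that(1)] that(2) by (intro rcos_self H) simp
    then show ?thesis
      using H.rcos_module_imp[OF G rep(1)[OF translate[OF that]]] by simp
  qed
  have "\<exists>w. w \<in> lists A \<and> word_value G w = ?h c b" if "c \<in> J" "b \<in> B" for c b
    using word_exists[OF H_group A, of "?h c b"] h[of c b] that B(2) unfolding word_value_H by auto
  then obtain f where f: "\<And>c b. c \<in> J \<Longrightarrow> b \<in> B \<Longrightarrow> f c b \<in> lists A \<and> word_value G (f c b) = ?h c b"
    by metis
  let ?\<delta> = "\<lambda>c b. c #> b"
  \<comment> \<open>One letter is emitted exactly when the truth value of \<open>c = H\<close>
    changes. Both automata of the family share the letter type, and \<open>undefined\<close> merely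
    names the single letter of the parity automaton.\<close>
  define toggle where "toggle c b = (if (c = H) = (c #> b = H) then [] else [undefined :: 'a])" for c b
  have closed: "word_value G w \<in> carrier G" if "w \<in> lists B" for w
    using word_value_append[OF G, of "[]" w] that B(2) lists_mono by blast
  have foldl: "foldl ?\<delta> c w = c #> word_value G w" if "w \<in> lists B" "c \<in> J" for c w
    using that
  proof (induction arbitrary: c)
    case Nil
    then show ?case using J_sub coset_mult_one by auto
  next
    case (Cons b w)
    then show ?case
      using J_sub[of c] coset_mult_assoc[of c b "word_value G w"] translate[of c b] closed[of w] B(2)
      by auto
  qed
  have lists: "transduce ?\<delta> f c w \<in> lists A" if "w \<in> lists B" "c \<in> J" for c w
    using that
  proof (induction arbitrary: c)
    case (Cons b w)
    then have "transduce ?\<delta> f (c #> b) w \<in> lists A"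
      using translate B(2) by blast
    then show ?case using f[OF Cons.prems Cons.hyps(1)] by simp
  qed simp
  \<comment> \<open>A telescoping product: the factor \<open>inv (rep ?c)\<close> ending one letter
    cancels the \<open>rep ?c\<close> starting the next.\<close>
  have val: "word_value G (transduce ?\<delta> f c w) = rep c \<otimes> word_value G w \<otimes> inv (rep (c #> word_value G w))"
    if "w \<in> lists B" "c \<in> J" for c w
    using that
  proof (induction arbitrary: c)
    case Nil
    then show ?case using J_sub coset_mult_one rep(1) by auto
  next
    case (Cons b w)
    have b: "b \<in> carrier G" using Cons.hyps(1) B(2) by blast
    let ?c = "c #> b" and ?g = "word_value G w"
    have c: "?c \<in> J" using translate Cons.prems b by blast
    have g: "?g \<in> carrier G" using closed Cons.hyps(2) by blast
    have cs: "c #> (b \<otimes> ?g) = ?c #> ?g"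
      using coset_mult_assoc[OF J_sub[OF Cons.prems] b g] by simp
    let ?r = "rep (?c #> ?g)"
    have r: "rep c \<in> carrier G" "rep ?c \<in> carrier G" "?r \<in> carrier G"
      using rep(1) Cons.prems c translate[OF c g] by blast+
    have "word_value G (f c b @ transduce ?\<delta> f ?c w) =
        word_value G (f c b) \<otimes> word_value G (transduce ?\<delta> f ?c w)"
      using word_value_append[OF G, of "f c b" "transduce ?\<delta> f ?c w"] f[OF Cons.prems Cons.hyps(1)]
        lists[OF Cons.hyps(2) c] AH H.subset lists_mono by blast
    also have "\<dots> = (rep c \<otimes> b \<otimes> inv (rep ?c)) \<otimes> (rep ?c \<otimes> ?g \<otimes> inv ?r)"
      using f[OF Cons.prems Cons.hyps(1)] Cons.IH[OF c] by simp
    also have "\<dots> = rep c \<otimes> (b \<otimes> ?g) \<otimes> inv ?r"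
    proof -
      have "inv (rep ?c) \<otimes> (rep ?c \<otimes> (?g \<otimes> inv ?r)) = ?g \<otimes> inv ?r"
        using r g by (simp add: m_assoc[symmetric])
      then show ?thesis using r b g by (simp add: m_assoc)
    qed
    finally show ?case using cs by simp
  qed
  \<comment> \<open>Modulo two, changes of the truth value of \<open>c = H\<close> along a path are
    determined by its two ends.\<close>
  have parity: "transduce ?\<delta> toggle c w \<in> lists {undefined} \<and>
      (odd (length (transduce ?\<delta> toggle c w)) \<longleftrightarrow> (c = H) \<noteq> (foldl ?\<delta> c w = H))" if "w \<in> lists B" for c w
    using that by (induction arbitrary: c) (auto simp: toggle_def)
  define La where "La i = (if i then coWP ?H A else {w \<in> lists {undefined}. odd (length w)})" for i
  show ?thesis
  proof (rule special_ET0L_transducer_family[where I = UNIV and J = J and \<delta> = ?\<delta>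
        and A = "\<lambda>i. if i then A else {undefined}" and out = "\<lambda>i. if i then f else toggle" and La = La])
    have in_La: "transduce ?\<delta> f c w \<in> La True \<longleftrightarrow>
        rep c \<otimes> word_value G w \<otimes> inv (rep (c #> word_value G w)) \<noteq> \<one>"
      "transduce ?\<delta> toggle c w \<in> La False \<longleftrightarrow> (c = H) \<noteq> (c #> word_value G w = H)"
      if "w \<in> lists B" "c \<in> J" for c w
      using lists[OF that] val[OF that] parity[OF that(1), of c] foldl[OF that] word_value_H
      by (simp_all add: La_def coWP_def)
    show "coWP G B = {w \<in> lists B. \<exists>i\<in>UNIV. \<exists>c\<in>J. transduce ?\<delta> (if i then f else toggle) c w \<in> La i}"
    proof (intro subset_antisym subsetI)
      fix w
      assume "w \<in> coWP G B"
      then have w: "w \<in> lists B" "word_value G w \<noteq> \<one>" by (simp_all add: coWP_def)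
      let ?g = "word_value G w"
      show "w \<in> {w \<in> lists B. \<exists>i\<in>UNIV. \<exists>c\<in>J. transduce ?\<delta> (if i then f else toggle) c w \<in> La i}"
      \<comment> \<open>To accept a nontrivial word the start coset \<open>H\<close> suffices:
        \<open>f\<close> serves values in \<open>H\<close>, \<open>toggle\<close> all
        others.\<close>
      proof (cases "H #> ?g = H")
        case True
        \<comment> \<open>The representative of \<open>H\<close> was chosen arbitrarily and may
          differ from one, so the value is a conjugate of \<open>?g\<close>.\<close>
        have "rep H \<otimes> ?g \<otimes> inv (rep H) \<noteq> \<one>"
        proof
          assume "rep H \<otimes> ?g \<otimes> inv (rep H) = \<one>"
          then have "rep H \<otimes> ?g = rep H"
            using rep(1)[OF H_in_J] closed[OF w(1)] inv_solve_right[of \<one> "rep H \<otimes> ?g" "rep H"] by simp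
          then show False using w(2) rep(1)[OF H_in_J] closed[OF w(1)] by simp
        qed
        then have "transduce ?\<delta> f H w \<in> La True"
          using in_La(1)[OF w(1) H_in_J] True by simp
        then show ?thesis using w(1) H_in_J by (auto intro!: exI[of _ True])
      next
        case False
        then have "transduce ?\<delta> toggle H w \<in> La False"
          using in_La(2)[OF w(1) H_in_J] by simp
        then show ?thesis using w(1) H_in_J by (auto intro!: exI[of _ False])
      qed
    next
      fix w
      assume "w \<in> {w \<in> lists B. \<exists>i\<in>UNIV. \<exists>c\<in>J. transduce ?\<delta> (if i then f else toggle) c w \<in> La i}"
      then obtain i c where w: "w \<in> lists B" "c \<in> J" "transduce ?\<delta> (if i then f else toggle) c w \<in> La i"
        by blast
      \<comment> \<open>Here any start coset may occur. A word of value one fixes it, so the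
        rewritten value cancels to one and the parity is even: neither automaton accepts.\<close>
      have "word_value G w \<noteq> \<one>"
      proof
        assume "word_value G w = \<one>"
        then show False
          using w(3) in_La[OF w(1,2)] coset_mult_one[OF J_sub[OF w(2)]] rep(1)[OF w(2)]
          by (cases i) simp_all
      qed
      then show "w \<in> coWP G B" using w(1) by (simp add: coWP_def)
    qed
    \<comment> \<open>Rejected words have value one, and the identity fixes all cosets.\<close>
    show "foldl ?\<delta> c v = c" if "v \<in> lists B" "v \<notin> coWP G B" "c \<in> J" for v c
      using foldl[OF that(1,3)] that(1,2) coset_mult_one[OF J_sub[OF that(3)]]
      by (simp add: coWP_def)
    show "special_ET0L (if i then A else {undefined}) (La i)" for i
      unfolding La_def using special special_ET0L_parity[of "undefined :: 'a"] by (cases i) simp_all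
    show "[] \<notin> La i" for i by (simp add: La_def coWP_def)
    show "c #> b \<in> J" if "c \<in> J" "b \<in> B" for c b
      using translate that B(2) by blast
    show "(if i then f else toggle) c b \<in> lists (if i then A else {undefined})" if "c \<in> J" "b \<in> B" for i c b
      using f[OF that] by (simp add: toggle_def)
    show "finite J" unfolding J_def by (rule finite)
  qed (use B in simp_all)
qed

section \<open>Subgroups, direct products and finite extensions\<close>

text \<open>The alphabet finally used is \<open>S\<close> together with the inverses of its
  elements; asking the last assumption for all finite \<open>B\<close> keeps this detail out of the
  applications.\<close>

lemma special_coET0L_groupI:
  assumes "group G" "finite S" "S \<subseteq> carrier G" "carrier G \<subseteq> generate G S"
    and "\<And>B. finite B \<Longrightarrow> B \<subseteq> carrier G \<Longrightarrow> special_ET0L B (coWP G B)"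
  shows "special_coET0L_group G"
proof -
  let ?B = "S \<union> (\<lambda>s. inv\<^bsub>G\<^esub> s) ` S"
  have B: "finite_symmetric_generating_set G ?B"
    by (rule finite_symmetric_generating_set_closure[OF assms(1-4)])
  then have "special_ET0L ?B (coWP G ?B)"
    unfolding finite_symmetric_generating_set_def by (intro assms(5)) simp_all
  then show ?thesis
    using B assms(1) unfolding special_coET0L_group_def by blast
qed

text \<open>The inclusion of \<open>H\<close> is injective on its own, so a family with one member
  is enough.\<close>

proposition special_ET0L_coWP_subgroup:
  assumes "group G" "finite_symmetric_generating_set G A" "special_ET0L A (coWP G A)"
    and "subgroup H G" "finite B" "B \<subseteq> H"
  shows "special_ET0L B (coWP (G\<lparr>carrier := H\<rparr>) B)"
proof (rule special_ET0L_coWP_jointly_injective[where I = "{()}" and G = "\<lambda>_. G" and \<phi> = "\<lambda>_ g. g"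
      and A = "\<lambda>_. A"])
  show K: "group (G\<lparr>carrier := H\<rparr>)" by (rule subgroup.subgroup_is_group[OF assms(4,1)])
  show "group_hom (G\<lparr>carrier := H\<rparr>) G (\<lambda>g. g)"
    using K assms(1) subgroup.subset[OF assms(4)]
    by (auto simp: group_hom_def group_hom_axioms_def hom_def)
qed (use assms in simp_all)

text \<open>The case of the improper subgroup: updating the carrier by itself leaves the values of
  words unchanged.\<close>

corollary special_ET0L_coWP_change_generators:
  assumes "group G" "finite_symmetric_generating_set G A" "special_ET0L A (coWP G A)"
    and "finite_symmetric_generating_set G B"
  shows "special_ET0L B (coWP G B)"
  using special_ET0L_coWP_subgroup[OF assms(1-3) group.subgroup_self[OF assms(1)], of B] assms(4)
  by (simp add: finite_symmetric_generating_set_def coWP_def word_value_def)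

proposition special_coET0L_group_subgroup:
  assumes "special_coET0L_group G" "subgroup H G" "finite S" "S \<subseteq> H" "generate G S = H"
  shows "special_coET0L_group (G\<lparr>carrier := H\<rparr>)"
proof -
  from assms(1) obtain A where G: "group G" and A: "finite_symmetric_generating_set G A"
    "special_ET0L A (coWP G A)"
    unfolding special_coET0L_group_def by blast
  show ?thesis
  proof (rule special_coET0L_groupI[where S = S])
    show "group (G\<lparr>carrier := H\<rparr>)" by (rule subgroup.subgroup_is_group[OF assms(2) G])
    show "carrier (G\<lparr>carrier := H\<rparr>) \<subseteq> generate (G\<lparr>carrier := H\<rparr>) S"
      using group.generate_consistent[OF G assms(4,2)] assms(5) by simp
  qed (use assms special_ET0L_coWP_subgroup[OF G A assms(2)] in simp_all)
qed

text \<open>The projections onto the factors are jointly injective. What remains is to find a finite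
  generating set, made up of the generators of all factors.\<close>

proposition special_coET0L_group_product:
  assumes "finite I" and "\<And>i. i \<in> I \<Longrightarrow> special_coET0L_group (G i)"
  shows "special_coET0L_group (product_group I G)"
proof -
  let ?K = "product_group I G"
  have group: "group (G i)" if "i \<in> I" for i
    using assms(2)[OF that] by (simp add: special_coET0L_group_def)
  then have K: "group ?K" by simp
  have "\<forall>i\<in>I. \<exists>A. finite_symmetric_generating_set (G i) A \<and> special_ET0L A (coWP (G i) A)"
    using assms(2) by (simp add: special_coET0L_group_def)
  then obtain A where A: "\<forall>i\<in>I. finite_symmetric_generating_set (G i) (A i) \<and> special_ET0L (A i) (coWP (G i) (A i))"
    by (rule bchoice[THEN exE])
  have AG: "A i \<subseteq> carrier (G i)" "\<And>a. a \<in> A i \<Longrightarrow> inv\<^bsub>G i\<^esub> a \<in> A i" "finite (A i)"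
    "generate (G i) (A i) = carrier (G i)" if "i \<in> I" for i
    using A that unfolding finite_symmetric_generating_set_def by blast+
  \<comment> \<open>The canonical embedding of the factor \<open>i\<close>.\<close>
  define single where "single i g = (\<lambda>k\<in>I. if k = i then g else \<one>\<^bsub>G k\<^esub>)" for i g
  define S where "S = (\<Union>i\<in>I. single i ` A i)"
  have single_mult: "single i (g \<otimes>\<^bsub>G i\<^esub> h) = single i g \<otimes>\<^bsub>?K\<^esub> single i h" if "i \<in> I" for i g h
    using group monoid.l_one[OF group.is_monoid[OF group]] group.is_monoid[OF group]
    by (auto simp: single_def fun_eq_iff monoid.l_one)
  have single_one: "single i \<one>\<^bsub>G i\<^esub> = \<one>\<^bsub>?K\<^esub>" for i
    by (auto simp: single_def fun_eq_iff)
  have single_generate: "single i g \<in> generate ?K S" if "i \<in> I" "g \<in> carrier (G i)" for i g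
  proof -
    have "g \<in> generate (G i) (A i)" using that AG by simp
    then show ?thesis
    proof (induction rule: generate.induct)
      case one
      show ?case unfolding single_one by (rule generate.one)
    next
      case (incl a)
      then show ?case using that(1) by (intro generate.incl) (auto simp: S_def)
    next
      case (inv a)
      then show ?case using that(1) AG(2) by (intro generate.incl) (auto simp: S_def)
    next
      case (eng g h)
      then show ?case unfolding single_mult[OF that(1)] by (intro generate.eng)
    qed
  qed
  \<comment> \<open>An element is the product of its components; the induction collects them one
    index at a time and is used for \<open>F = I\<close>.\<close>
  have restrict_generate: "(\<lambda>k\<in>I. if k \<in> F then f k else \<one>\<^bsub>G k\<^esub>) \<in> generate ?K S"
    if "f \<in> carrier ?K" "finite F" "F \<subseteq> I" for f F
    using that(2,3)
  proof (induction rule: finite_induct)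
    case empty
    have "(\<lambda>k\<in>I. if k \<in> {} then f k else \<one>\<^bsub>G k\<^esub>) = \<one>\<^bsub>?K\<^esub>" by simp
    then show ?case by (simp only: generate.one)
  next
    case (insert i F)
    have "f k \<in> carrier (G k)" if "k \<in> I" for k
      using \<open>f \<in> carrier ?K\<close> that by auto
    then have eq: "(\<lambda>k\<in>I. if k \<in> insert i F then f k else \<one>\<^bsub>G k\<^esub>) =
        single i (f i) \<otimes>\<^bsub>?K\<^esub> (\<lambda>k\<in>I. if k \<in> F then f k else \<one>\<^bsub>G k\<^esub>)"
      using insert.hyps(2) group.is_monoid[OF group]
      by (auto simp: single_def fun_eq_iff monoid.l_one monoid.r_one)
    have "single i (f i) \<in> generate ?K S"
      using insert.prems \<open>f \<in> carrier ?K\<close> by (intro single_generate) auto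
    moreover have "F \<subseteq> I" using insert.prems by simp
    ultimately show ?case
      unfolding eq by (intro generate.eng insert.IH)
  qed
  show ?thesis
  proof (rule special_coET0L_groupI[where S = S])
    show "finite S" unfolding S_def using assms(1) AG(3) by auto
    show "S \<subseteq> carrier ?K"
      unfolding S_def single_def using AG(1) group.is_monoid[OF group] monoid.one_closed by fastforce
    show "carrier ?K \<subseteq> generate ?K S"
    proof
      fix f
      assume f: "f \<in> carrier ?K"
      then have "(\<lambda>k\<in>I. if k \<in> I then f k else \<one>\<^bsub>G k\<^esub>) = f"
        by (auto simp: fun_eq_iff PiE_iff extensional_def)
      then show "f \<in> generate ?K S" using restrict_generate[OF f assms(1) subset_refl] by simp
    qed
    show "special_ET0L B (coWP ?K B)" if "finite B" "B \<subseteq> carrier ?K" for B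
    proof (rule special_ET0L_coWP_jointly_injective[where G = G and \<phi> = "\<lambda>i f. f i" and A = A])
      show "group_hom ?K (G i) (\<lambda>f. f i)" if "i \<in> I" for i
        using that group K by (auto simp: group_hom_def group_hom_axioms_def hom_def)
      show "f = \<one>\<^bsub>?K\<^esub>" if "f \<in> carrier ?K" "\<And>i. i \<in> I \<Longrightarrow> f i = \<one>\<^bsub>G i\<^esub>" for f
        using that by (auto simp: fun_eq_iff PiE_iff extensional_def)
    qed (use K that assms(1) A in simp_all)
  qed (rule K)
qed

text \<open>Finite generation of \<open>G\<close> has to be derived: the generators of
  \<open>H\<close> and one representative of each of the finitely many cosets suffice, as every
  element is a product of some \<open>h \<in> H\<close> and a representative.\<close>

proposition special_coET0L_group_finite_extension:
  fixes G (structure)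
  assumes G: "group G" and H: "subgroup H G" and finite: "finite (rcosets\<^bsub>G\<^esub> H)"
    and special: "special_coET0L_group (G\<lparr>carrier := H\<rparr>)"
  shows "special_coET0L_group G"
proof -
  interpret group G by fact
  from special obtain A where A: "finite_symmetric_generating_set (G\<lparr>carrier := H\<rparr>) A"
      "special_ET0L A (coWP (G\<lparr>carrier := H\<rparr>) A)"
    unfolding special_coET0L_group_def by blast
  then have AH: "A \<subseteq> H" "finite A" and gen: "generate G A = H"
    using generate_consistent[OF _ H, of A] by (simp_all add: finite_symmetric_generating_set_def)
  have HG: "H \<subseteq> carrier G" by (rule subgroup.subset[OF H])
  define T where "T = (\<lambda>c. SOME g. g \<in> c) ` (rcosets H)"
  have rep: "(SOME g. g \<in> H #> x) \<in> H #> x" if "x \<in> carrier G" for x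
    using rcos_self[OF that H] someI[of "\<lambda>g. g \<in> H #> x" x] by blast
  have T: "T \<subseteq> carrier G"
    using rep r_coset_subset_G[OF HG] unfolding T_def RCOSETS_def by blast
  show ?thesis
  proof (rule special_coET0L_groupI[where S = "A \<union> T"])
    show "carrier G \<subseteq> generate G (A \<union> T)"
    proof
      fix x
      assume x: "x \<in> carrier G"
      let ?t = "SOME g. g \<in> H #> x"
      have t: "?t \<in> T" unfolding T_def using rcosetsI[OF HG x] by blast
      have "H #> x = H #> ?t"
        by (rule repr_independence[OF rep[OF x] x H])
      then have "x \<in> H #> ?t" using rcos_self[OF x H] by simp
      then obtain h where h: "h \<in> H" "x = h \<otimes> ?t" unfolding r_coset_def by blast
      have "h \<in> generate G (A \<union> T)"
        using h(1) gen mono_generate[of A "A \<union> T"] by blast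
      moreover have "?t \<in> generate G (A \<union> T)" using t by (intro generate.incl) simp
      ultimately show "x \<in> generate G (A \<union> T)" by (subst h(2)) (rule generate.eng)
    qed
    show "finite (A \<union> T)" using AH(2) finite by (simp add: T_def)
    show "A \<union> T \<subseteq> carrier G" using AH(1) HG T by blast
  qed (use G special_ET0L_coWP_finite_index[OF G H finite A] in simp_all)
qed

theorem theorem6p1:
  shows "(\<forall>(G :: ('a, 'm) monoid_scheme) A B.
            group G \<and> finite_symmetric_generating_set G A \<and> finite_symmetric_generating_set G B \<longrightarrow>
            (special_ET0L A (coWP G A) \<longleftrightarrow> special_ET0L B (coWP G B)))
       \<and> (\<forall>(G :: ('b, 'n) monoid_scheme) H.
            special_coET0L_group G \<and> subgroup H G \<and> (\<exists>S. finite S \<and> S \<subseteq> H \<and> generate G S = H) \<longrightarrow>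
            special_coET0L_group (G\<lparr>carrier := H\<rparr>))
       \<and> (\<forall>(I :: 'i set) (G :: 'i \<Rightarrow> ('c, 'k) monoid_scheme).
            finite I \<and> (\<forall>i\<in>I. special_coET0L_group (G i)) \<longrightarrow>
            special_coET0L_group (product_group I G))
       \<and> (\<forall>(G :: ('d, 'l) monoid_scheme) H.
            group G \<and> subgroup H G \<and> finite (rcosets\<^bsub>G\<^esub> H) \<and>
            special_coET0L_group (G\<lparr>carrier := H\<rparr>) \<longrightarrow>
            special_coET0L_group G)"
proof (intro conjI allI impI)
  fix G :: "('a, 'm) monoid_scheme" and A B
  assume "group G \<and> finite_symmetric_generating_set G A \<and> finite_symmetric_generating_set G B"
  then show "special_ET0L A (coWP G A) \<longleftrightarrow> special_ET0L B (coWP G B)"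
    using special_ET0L_coWP_change_generators by blast
next
  fix G :: "('b, 'n) monoid_scheme" and H
  assume "special_coET0L_group G \<and> subgroup H G \<and> (\<exists>S. finite S \<and> S \<subseteq> H \<and> generate G S = H)"
  then show "special_coET0L_group (G\<lparr>carrier := H\<rparr>)"
    using special_coET0L_group_subgroup by blast
next
  fix I :: "'i set" and G :: "'i \<Rightarrow> ('c, 'k) monoid_scheme"
  assume "finite I \<and> (\<forall>i\<in>I. special_coET0L_group (G i))"
  then show "special_coET0L_group (product_group I G)"
    by (intro special_coET0L_group_product) blast+
next
  fix G :: "('d, 'l) monoid_scheme" and H
  assume "group G \<and> subgroup H G \<and> finite (rcosets\<^bsub>G\<^esub> H) \<and> special_coET0L_group (G\<lparr>carrier := H\<rparr>)"
  then show "special_coET0L_group G"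
    using special_coET0L_group_finite_extension by blast
qed

end
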